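(* Let $(\tilde{\mathcal{C}},\tilde\lambda)$ be a $(2n+3)$-dimensional contact manifold with canonical coordinates $(x,x^{n+1},p,p_{n+1},z)$, $x=\{x^1,\dots,x^n\}$, $p=\{p_1,\dots,p_n\}$, $\tilde\lambda=dz-p_a\,dx^a-p_{n+1}\,dx^{n+1}$. Let $\varphi$ be a function of $p$, $x^{n+1}_{(0)}$ a non-zero constant, $\tilde\varphi(p,p_{n+1})=\varphi(p)+p_{n+1}x^{n+1}_{(0)}$, and let $F_1,\dots,F_n$ be functions of $p$ on the Legendre submanifold $\mathcal{A}_\varphi$ generated by $-\varphi$ (parametrized by $p$), which do not identically vanish. Let $\tilde\Gamma$ be a function of one variable, and write $\tilde\Gamma'=d\tilde\Gamma/d\tilde\Delta^0$. Then the flow of the vector field $\dot p_a\,\partial/\partial p_a$, $\dot p_a=F_a(p)$, on $\mathcal{A}_\varphi$ is lifted to $\tilde{\mathcal{C}}$ as the flow of the vector field $$\tilde X=\dot x^a\frac{\partial}{\partial x^a}+\dot x^{n+1}\frac{\partial}{\partial x^{n+1}}+\dot p_a\frac{\partial}{\partial p_a}+\dot p_{n+1}\frac{\partial}{\partial p_{n+1}}+\dot z\frac{\partial}{\partial z}$$ with $$\dot x^a=\frac{x^{n+1}}{x^{n+1}_{(0)}}\frac{\partial^2\varphi}{\partial p_a\partial p_i}F_i-\tilde\Delta^i\frac{\partial F_i}{\partial p_a}+\tilde\Gamma'\Big(\frac{\partial\varphi}{\partial p_a}-x^a\Big),$$ $$\dot x^{n+1}=\tilde\Gamma'\,\big(x^{n+1}_{(0)}-x^{n+1}\big),\qquad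 \dot p_a=F_a,\qquad \dot p_{n+1}=-\frac{1}{x^{n+1}_{(0)}}\frac{\partial\varphi}{\partial p_i}F_i,$$ $$\dot z=\tilde\Delta^iF_i+\tilde\Gamma+\frac{x^{n+1}}{x^{n+1}_{(0)}}p_i\frac{\partial^2\varphi}{\partial p_i\partial p_a}F_a-p_i\tilde\Delta^a\frac{\partial F_a}{\partial p_i}-\Big[x^ip_i+\big(x^{n+1}-x^{n+1}_{(0)}\big)p_{n+1}-p_i\frac{\partial\varphi}{\partial p_i}\Big]\tilde\Gamma'.$$ Equivalently, these can be written as $$\dot p_a=F_a(p),\quad \dot p_{n+1}=-\frac{1}{x^{n+1}_{(0)}}\frac{\partial\varphi}{\partial p_i}F_i,\quad \dot x^{n+1}=\tilde\Gamma'\,\big(x^{n+1}_{(0)}-x^{n+1}\big),$$ $$\frac{d\tilde\Delta^a}{dt}=-\frac{\partial F_i}{\partial p_a}\tilde\Delta^i-\tilde\Gamma'\,\tilde\Delta^a,\qquad \frac{d\tilde\Delta^0}{dt}=-\tilde\Gamma(\tilde\Delta^0).$$ Moreover $\tilde X$ is the contact Hamiltonian vector field associated to the contact Hamiltonian $$\tilde h(x,x^{n+1},p,p_{n+1},z)=\tilde\Delta^a(x,x^{n+1},p)F_a(p)+\tilde\Gamma(\tilde\Delta^0(x,x^{n+1},p,p_{n+1},z)),$$ and it satisfies $\mathcal{L}_{\tilde X}\tilde\varphi=0$.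
   Context: All objects are smooth; repeated indices $a,i$ are summed over $1,\dots,n$. Put $$\tilde\Delta^0=x^ip_i+\big(x^{n+1}-x^{n+1}_{(0)}\big)p_{n+1}-\varphi(p)-z,\qquad \tilde\Delta^a=x^a-\frac{x^{n+1}}{x^{n+1}_{(0)}}\frac{\partial\varphi}{\partial p_a}(p).$$ A flow on $\tilde{\mathcal{C}}$ is a lift of a flow on $\mathcal{A}_\varphi$ if the projection $\pi(x,x^{n+1},p,p_{n+1},z)=p$ intertwines them. The contact Hamiltonian vector field of a function $\tilde h$ on $\tilde{\mathcal{C}}$ is defined by $\iota_{\tilde X}\tilde\lambda=\tilde h$, $\iota_{\tilde X}d\tilde\lambda=-(d\tilde h-(\partial\tilde h/\partial z)\tilde\lambda)$; in coordinates, for $\mu=1,\dots,n+1$, $\dot x^\mu=-\partial\tilde h/\partial p_\mu$, $\dot p_\mu=\partial\tilde h/\partial x^\mu+p_\mu\,\partial\tilde h/\partial z$, $\dot z=\tilde h-\sum_{\mu=1}^{n+1}p_\mu\,\partial\tilde h/\partial p_\mu$. $\mathcal{L}$ denotes the Lie derivative. *)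

theory Defs
  imports "HOL-Analysis.Analysis"
begin

primrec higher_differentiable_on ::
    "nat \<Rightarrow> 'a::real_normed_vector set \<Rightarrow> ('a \<Rightarrow> 'b::real_normed_vector) \<Rightarrow> bool" where
  "higher_differentiable_on 0 S f \<longleftrightarrow> continuous_on S f"
| "higher_differentiable_on (Suc k) S f \<longleftrightarrow>
     (\<forall>x\<in>S. f differentiable (at x)) \<and>
     (\<forall>v. higher_differentiable_on k S (\<lambda>x. frechet_derivative f (at x) v))"

text \<open>Meant for open \<open>S\<close> in a finite-dimensional space, where it is the usual
  \<open>C\<close>-infinity condition.\<close>

definition smooth_on :: "'a::real_normed_vector set \<Rightarrow> ('a \<Rightarrow> 'b::real_normed_vector) \<Rightarrow> bool" where
  "smooth_on S f \<longleftrightarrow> (\<forall>k. higher_differentiable_on k S f)"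

definition pd :: "'n::finite \<Rightarrow> (real^'n \<Rightarrow> real) \<Rightarrow> real^'n \<Rightarrow> real" where
  "pd a f p = frechet_derivative f (at p) (axis a 1)"

text \<open>The set \<open>M\<close> is an open subset of a Euclidean space or an embedded submanifold of one;
  in the latter case \<open>X\<close> is tangent to \<open>M\<close>. Vector fields need not be complete, so flows are
  local: \<open>flow_domain M X q\<close> is the maximal interval of existence of the integral curve
  through \<open>q\<close>. For smooth \<open>X\<close> integral curves are unique, and the definite description in
  \<open>flow\<close> is proper on that interval.\<close>

definition integral_curve ::
    "'a::real_normed_vector set \<Rightarrow> ('a \<Rightarrow> 'a) \<Rightarrow> real set \<Rightarrow> (real \<Rightarrow> 'a) \<Rightarrow> bool" where
  "integral_curve M X J \<gamma> \<longleftrightarrow>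
     open J \<and> is_interval J \<and>
     (\<forall>t\<in>J. \<gamma> t \<in> M \<and> (\<gamma> has_vector_derivative X (\<gamma> t)) (at t))"

definition flow_reaches ::
    "'a::real_normed_vector set \<Rightarrow> ('a \<Rightarrow> 'a) \<Rightarrow> real \<Rightarrow> 'a \<Rightarrow> 'a \<Rightarrow> bool" where
  "flow_reaches M X t q y \<longleftrightarrow>
     (\<exists>J \<gamma>. integral_curve M X J \<gamma> \<and> 0 \<in> J \<and> t \<in> J \<and> \<gamma> 0 = q \<and> \<gamma> t = y)"

definition flow_domain ::
    "'a::real_normed_vector set \<Rightarrow> ('a \<Rightarrow> 'a) \<Rightarrow> 'a \<Rightarrow> real set" where
  "flow_domain M X q = {t. \<exists>y. flow_reaches M X t q y}"

definition flow ::
    "'a::real_normed_vector set \<Rightarrow> ('a \<Rightarrow> 'a) \<Rightarrow> real \<Rightarrow> 'a \<Rightarrow> 'a" where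
  "flow M X t q = (THE y. flow_reaches M X t q y)"

text \<open>The flow of \<open>X\<close> on \<open>M\<close> is a lift of the flow of \<open>Y\<close> on \<open>N\<close> along the projection \<open>\<pi>\<close>.\<close>

definition flow_lift ::
    "('a::real_normed_vector \<Rightarrow> 'b::real_normed_vector) \<Rightarrow> 'a set \<Rightarrow> ('a \<Rightarrow> 'a) \<Rightarrow>
      'b set \<Rightarrow> ('b \<Rightarrow> 'b) \<Rightarrow> bool" where
  "flow_lift \<pi> M X N Y \<longleftrightarrow>
     (\<forall>q\<in>M. \<pi> q \<in> N) \<and>
     (\<forall>q\<in>M. \<forall>t\<in>flow_domain M X q.
        t \<in> flow_domain N Y (\<pi> q) \<and> \<pi> (flow M X t q) = flow N Y t (\<pi> q))"

text \<open>It lies in the \<open>(2n+1)\<close>-dimensional space with canonical coordinates \<open>(x, p, z)\<close> and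
  contact form \<open>dz - p\<^sub>a dx\<^sup>a\<close>. A generating function \<open>f\<close> of \<open>p\<close> gives \<open>x\<^sup>a = -\<partial>f/\<partial>p\<^sub>a\<close>
  and \<open>z = f - p\<^sub>a \<partial>f/\<partial>p\<^sub>a\<close>; here \<open>f = -\<phi>\<close>.\<close>

definition legendre_param ::
    "(real^'n::finite \<Rightarrow> real) \<Rightarrow> real^'n \<Rightarrow> (real^'n) \<times> (real^'n) \<times> real" where
  "legendre_param \<phi> p = ((\<chi> a. pd a \<phi> p), p, (\<Sum>a\<in>UNIV. p $ a * pd a \<phi> p) - \<phi> p)"

definition legendre_submanifold ::
    "(real^'n::finite) set \<Rightarrow> (real^'n \<Rightarrow> real) \<Rightarrow> ((real^'n) \<times> (real^'n) \<times> real) set" where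
  "legendre_submanifold P \<phi> = legendre_param \<phi> ` P"

text \<open>The vector field \<open>F\<^sub>a(p) \<partial>/\<partial>p\<^sub>a\<close> in the global chart \<open>p\<close> of the submanifold, written as a
  tangent vector of the ambient space.\<close>

definition legendre_field ::
    "(real^'n::finite \<Rightarrow> real) \<Rightarrow> ('n \<Rightarrow> real^'n \<Rightarrow> real) \<Rightarrow>
      (real^'n) \<times> (real^'n) \<times> real \<Rightarrow> (real^'n) \<times> (real^'n) \<times> real" where
  "legendre_field \<phi> F = (\<lambda>(x, p, z). frechet_derivative (legendre_param \<phi>) (at p) (\<chi> a. F a p))"

text \<open>Points are \<open>(x, x\<^sup>n\<^sup>+\<^sup>1, p, p\<^sub>n\<^sub>+\<^sub>1, z)\<close>; the coordinates \<open>x\<^sup>n\<^sup>+\<^sup>1\<close> and \<open>p\<^sub>n\<^sub>+\<^sub>1\<close> are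
  written \<open>xn\<close> and \<open>pn\<close>, and the constant \<open>x\<^sup>n\<^sup>+\<^sup>1\<close> with subscript \<open>(0)\<close> is written \<open>x0\<close>.\<close>

type_synonym 'n extended = "(real^'n) \<times> real \<times> (real^'n) \<times> real \<times> real"

definition contact_form :: "'n::finite extended \<Rightarrow> 'n extended \<Rightarrow> real" where
  "contact_form = (\<lambda>(x, xn, p, pn, z) (dx, dxn, dp, dpn, dz).
     dz - (\<Sum>a\<in>UNIV. p $ a * dx $ a) - pn * dxn)"

text \<open>Exterior derivative of a one-form on an open subset of a vector space, with the convention
  \<open>d\<alpha>(u, v) = u(\<alpha>(v)) - v(\<alpha>(u))\<close> for constant vector fields \<open>u\<close>, \<open>v\<close>; thus
  \<open>dx \<and> dp\<close> is \<open>dx \<otimes> dp - dp \<otimes> dx\<close>.\<close>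

definition ext_deriv ::
    "('a::real_normed_vector \<Rightarrow> 'a \<Rightarrow> real) \<Rightarrow> 'a \<Rightarrow> 'a \<Rightarrow> 'a \<Rightarrow> real" where
  "ext_deriv \<alpha> q u v =
     frechet_derivative (\<lambda>q. \<alpha> q v) (at q) u - frechet_derivative (\<lambda>q. \<alpha> q u) (at q) v"

definition lie_deriv_fun ::
    "('a::real_normed_vector \<Rightarrow> 'a) \<Rightarrow> ('a \<Rightarrow> real) \<Rightarrow> 'a \<Rightarrow> real" where
  "lie_deriv_fun X f q = frechet_derivative f (at q) (X q)"

definition pd_z :: "('n::finite extended \<Rightarrow> real) \<Rightarrow> 'n extended \<Rightarrow> real" where
  "pd_z f q = frechet_derivative f (at q) (0, 0, 0, 0, 1)"

definition contact_hamiltonian_field ::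
    "'n::finite extended set \<Rightarrow> ('n extended \<Rightarrow> real) \<Rightarrow> ('n extended \<Rightarrow> 'n extended) \<Rightarrow> bool" where
  "contact_hamiltonian_field U h X \<longleftrightarrow>
     (\<forall>q\<in>U. contact_form q (X q) = h q \<and>
        (\<forall>v. ext_deriv contact_form q (X q) v =
             - (frechet_derivative h (at q) v - pd_z h q * contact_form q v)))"

definition xn_coord :: "'n::finite extended \<Rightarrow> real" where
  "xn_coord = (\<lambda>(x, xn, p, pn, z). xn)"

definition p_coord :: "'n::finite extended \<Rightarrow> real^'n" where
  "p_coord = (\<lambda>(x, xn, p, pn, z). p)"

definition pn_coord :: "'n::finite extended \<Rightarrow> real" where
  "pn_coord = (\<lambda>(x, xn, p, pn, z). pn)"

text \<open>The projection \<open>(x, x\<^sup>n\<^sup>+\<^sup>1, p, p\<^sub>n\<^sub>+\<^sub>1, z) \<mapsto> p\<close>, where \<open>p\<close> stands for the point of the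
  Legendre submanifold with coordinate \<open>p\<close>.\<close>

definition legendre_proj ::
    "(real^'n::finite \<Rightarrow> real) \<Rightarrow> 'n extended \<Rightarrow> (real^'n) \<times> (real^'n) \<times> real" where
  "legendre_proj \<phi> q = legendre_param \<phi> (p_coord q)"

definition phi_ext :: "(real^'n::finite \<Rightarrow> real) \<Rightarrow> real \<Rightarrow> 'n extended \<Rightarrow> real" where
  "phi_ext \<phi> x0 = (\<lambda>(x, xn, p, pn, z). \<phi> p + pn * x0)"

definition Delta0 :: "(real^'n::finite \<Rightarrow> real) \<Rightarrow> real \<Rightarrow> 'n extended \<Rightarrow> real" where
  "Delta0 \<phi> x0 = (\<lambda>(x, xn, p, pn, z).
     (\<Sum>i\<in>UNIV. x $ i * p $ i) + (xn - x0) * pn - \<phi> p - z)"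

definition Delta :: "(real^'n::finite \<Rightarrow> real) \<Rightarrow> real \<Rightarrow> 'n \<Rightarrow> 'n extended \<Rightarrow> real" where
  "Delta \<phi> x0 a = (\<lambda>(x, xn, p, pn, z). x $ a - xn / x0 * pd a \<phi> p)"

definition lift_hamiltonian ::
    "(real^'n::finite \<Rightarrow> real) \<Rightarrow> real \<Rightarrow> ('n \<Rightarrow> real^'n \<Rightarrow> real) \<Rightarrow> (real \<Rightarrow> real) \<Rightarrow>
      'n extended \<Rightarrow> real" where
  "lift_hamiltonian \<phi> x0 F \<Gamma> q =
     (\<Sum>a\<in>UNIV. Delta \<phi> x0 a q * F a (p_coord q)) + \<Gamma> (Delta0 \<phi> x0 q)"

definition lift_field ::
    "(real^'n::finite \<Rightarrow> real) \<Rightarrow> real \<Rightarrow> ('n \<Rightarrow> real^'n \<Rightarrow> real) \<Rightarrow> (real \<Rightarrow> real) \<Rightarrow>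
      'n extended \<Rightarrow> 'n extended" where
  "lift_field \<phi> x0 F \<Gamma> = (\<lambda>(x, xn, p, pn, z).
     let D = (\<lambda>a. Delta \<phi> x0 a (x, xn, p, pn, z));
         D0 = Delta0 \<phi> x0 (x, xn, p, pn, z);
         \<Gamma>' = deriv \<Gamma> D0
     in ((\<chi> a. xn / x0 * (\<Sum>i\<in>UNIV. pd a (pd i \<phi>) p * F i p)
               - (\<Sum>i\<in>UNIV. D i * pd a (F i) p)
               + \<Gamma>' * (pd a \<phi> p - x $ a)),
         \<Gamma>' * (x0 - xn),
         (\<chi> a. F a p),
         - (1 / x0) * (\<Sum>i\<in>UNIV. pd i \<phi> p * F i p),
         (\<Sum>i\<in>UNIV. D i * F i p) + \<Gamma> D0
           + xn / x0 * (\<Sum>i\<in>UNIV. \<Sum>a\<in>UNIV. p $ i * pd i (pd a \<phi>) p * F a p)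
           - (\<Sum>i\<in>UNIV. \<Sum>a\<in>UNIV. p $ i * D a * pd i (F a) p)
           - ((\<Sum>i\<in>UNIV. x $ i * p $ i) + (xn - x0) * pn
                - (\<Sum>i\<in>UNIV. p $ i * pd i \<phi> p)) * \<Gamma>'))"

end

theory Submission
  imports Defs
begin

text \<open>The vector field \<open>lift_field\<close> is the coordinate expression of the contact Hamiltonian
  field, so the contact statement is a computation with the differential of the Hamiltonian.
  Since \<open>\<Delta>\<^sup>a\<close> and \<open>\<Delta>\<^sup>0\<close> may replace \<open>x\<^sup>a\<close> and \<open>z\<close> as coordinates, the equations for them are
  obtained by the chain rule in both directions; this needs the symmetry of the Hessian of
  \<open>\<phi>\<close>. The \<open>p\<close>-components of the field depend on \<open>p\<close> only, so integral curves project to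
  integral curves. Integral curves are unique by a Gronwall argument, because the fields are
  locally Lipschitz, and therefore the projection intertwines the flows.\<close>

subsection \<open>Smooth functions\<close>

text \<open>Two cancellations explain the field. The term
  \<open>\<Gamma> (Delta0 \<phi> x0 q)\<close> does not influence the momenta: the derivative of
  \<open>Delta0\<close> in x^\<mu> is p_\<mu> and its z-derivative is -1, so
  \<partial>/\<partial>x^\<mu> + p_\<mu> \<partial>/\<partial>z annihilates it, and the term linear
  in \<open>Delta\<close> alone gives dp/dt = F(p). The velocity of \<open>pn\<close> in turn
  compensates the change of \<phi>(p) along \<open>F\<close>, which keeps \<open>phi_ext\<close>
  constant. Two obstacles shape the argument. \<open>flow\<close> is a definite description, so
  uniqueness is required both in \<open>U\<close> and on the Legendre submanifold; the latter is not
  open, and uniqueness there is inherited from the chart p. Moreover, the equations in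
  \<open>Delta\<close> and \<open>Delta0\<close> only prescribe derivatives of real functions of
  time, so differentiability of the curve itself has to be recovered by solving for x and z.\<close>

lemma smooth_on_differentiable:
  assumes "smooth_on S f" "x \<in> S"
  shows "f differentiable (at x)"
proof -
  have "higher_differentiable_on (Suc 0) S f"
    using assms(1) unfolding smooth_on_def by blast
  then show ?thesis using assms(2) by simp
qed

lemma smooth_on_frechet_derivative:
  assumes "smooth_on S f"
  shows "smooth_on S (\<lambda>x. frechet_derivative f (at x) v)"
  unfolding smooth_on_def
proof
  fix k
  have "higher_differentiable_on (Suc k) S f"
    using assms unfolding smooth_on_def by blast
  then show "higher_differentiable_on k S (\<lambda>x. frechet_derivative f (at x) v)" by simp
qed

lemma smooth_on_continuous_on:
  assumes "smooth_on S f"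
  shows "continuous_on S f"
proof -
  have "higher_differentiable_on 0 S f"
    using assms unfolding smooth_on_def by blast
  then show ?thesis by simp
qed

lemma smooth_on_pd: "smooth_on S f \<Longrightarrow> smooth_on S (pd a f)"
  using smooth_on_frechet_derivative[of S f "axis a 1"]
  by (simp add: pd_def[abs_def])

section \<open>Gradients and the symmetry of second derivatives\<close>

definition grad :: "(real^'n::finite \<Rightarrow> real) \<Rightarrow> real^'n \<Rightarrow> real^'n" where
  "grad f p = (\<chi> a. pd a f p)"

lemma has_derivative_grad:
  assumes "f differentiable (at p)"
  shows "(f has_derivative (\<lambda>v. grad f p \<bullet> v)) (at p)"
proof -
  have D: "(f has_derivative frechet_derivative f (at p)) (at p)"
    using assms by (simp add: frechet_derivative_works)
  then have lin: "linear (frechet_derivative f (at p))"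
    by (rule has_derivative_linear)
  have "frechet_derivative f (at p) v = grad f p \<bullet> v" for v
  proof -
    have "frechet_derivative f (at p) v = frechet_derivative f (at p) (\<Sum>i\<in>UNIV. v $ i *\<^sub>R axis i 1)"
      using basis_expansion[of v] by (simp add: scalar_mult_eq_scaleR)
    also have "\<dots> = (\<Sum>i\<in>UNIV. v $ i * frechet_derivative f (at p) (axis i 1))"
      using lin by (simp add: linear_sum linear_cmul)
    also have "\<dots> = grad f p \<bullet> v"
      by (simp add: inner_vec_def grad_def pd_def mult.commute)
    finally show ?thesis .
  qed
  then have "frechet_derivative f (at p) = (\<lambda>v. grad f p \<bullet> v)" by blast
  with D show ?thesis by metis
qed

text \<open>Two applications of the mean value theorem: one to the increment in direction
  \<open>v\<close>, viewed as a function of the distance travelled along \<open>u\<close>, and one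
  to the resulting increment of the directional derivative. The left side does not change when
  \<open>u\<close> and \<open>v\<close> are exchanged, which makes it a tool for mixed
  derivatives.\<close>

lemma second_difference_mean_value:
  fixes f :: "'a::real_normed_vector \<Rightarrow> real"
  assumes h: "0 < h"
    and S: "\<And>s t. s \<in> {0..h} \<Longrightarrow> t \<in> {0..h} \<Longrightarrow> p + s *\<^sub>R u + t *\<^sub>R v \<in> S"
    and f: "\<And>x. x \<in> S \<Longrightarrow> f differentiable (at x)"
    and f': "\<And>x. x \<in> S \<Longrightarrow> (\<lambda>x. frechet_derivative f (at x) u) differentiable (at x)"
  shows "\<exists>s\<in>{0..h}. \<exists>t\<in>{0..h}.
    f (p + h *\<^sub>R u + h *\<^sub>R v) - f (p + h *\<^sub>R u) - f (p + h *\<^sub>R v) + f p =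
    h * h * frechet_derivative (\<lambda>x. frechet_derivative f (at x) u) (at (p + s *\<^sub>R u + t *\<^sub>R v)) v"
proof -
  let ?g = "\<lambda>x. frechet_derivative f (at x) u"
  have along: "((\<lambda>r. k (c + r *\<^sub>R w)) has_real_derivative frechet_derivative k (at (c + r *\<^sub>R w)) w) (at r)"
    if "k differentiable (at (c + r *\<^sub>R w))" for k :: "'a \<Rightarrow> real" and c w r
  proof -
    have D: "(k has_derivative frechet_derivative k (at (c + r *\<^sub>R w))) (at (c + r *\<^sub>R w))"
      using that by (simp add: frechet_derivative_works)
    have "((\<lambda>r. c + r *\<^sub>R w) has_derivative (\<lambda>d. d *\<^sub>R w)) (at r)"
      by (auto intro!: derivative_eq_intros)
    from has_derivative_compose[OF this D]
    have "((\<lambda>r. k (c + r *\<^sub>R w)) has_derivative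
            (\<lambda>d. frechet_derivative k (at (c + r *\<^sub>R w)) (d *\<^sub>R w))) (at r)" .
    then show ?thesis
      using linear_cmul[OF has_derivative_linear[OF D]]
      by (simp add: has_field_derivative_def mult_commute_abs)
  qed
  have "\<exists>s>0. s < h \<and>
      (f ((p + h *\<^sub>R v) + h *\<^sub>R u) - f (p + h *\<^sub>R u)) - (f ((p + h *\<^sub>R v) + 0 *\<^sub>R u) - f (p + 0 *\<^sub>R u)) =
      (h - 0) * (?g ((p + h *\<^sub>R v) + s *\<^sub>R u) - ?g (p + s *\<^sub>R u))"
  proof (rule MVT2[OF h])
    fix s assume s: "0 \<le> s" "s \<le> h"
    have "f differentiable (at ((p + h *\<^sub>R v) + s *\<^sub>R u))"
      using f[OF S[of s h]] s h by (simp add: algebra_simps)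
    moreover have "f differentiable (at (p + s *\<^sub>R u))"
      using f[OF S[of s 0]] s h by simp
    ultimately show "((\<lambda>s. f ((p + h *\<^sub>R v) + s *\<^sub>R u) - f (p + s *\<^sub>R u)) has_real_derivative
      ?g ((p + h *\<^sub>R v) + s *\<^sub>R u) - ?g (p + s *\<^sub>R u)) (at s)"
      by (intro DERIV_diff along)
  qed
  then obtain s where s: "0 < s" "s < h" and
    1: "f (p + h *\<^sub>R u + h *\<^sub>R v) - f (p + h *\<^sub>R u) - f (p + h *\<^sub>R v) + f p =
      h * (?g (p + s *\<^sub>R u + h *\<^sub>R v) - ?g (p + s *\<^sub>R u))"
    by (auto simp: algebra_simps)
  have "\<exists>t>0. t < h \<and> ?g ((p + s *\<^sub>R u) + h *\<^sub>R v) - ?g ((p + s *\<^sub>R u) + 0 *\<^sub>R v) =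
      (h - 0) * frechet_derivative ?g (at ((p + s *\<^sub>R u) + t *\<^sub>R v)) v"
  proof (rule MVT2[OF h])
    fix t assume "0 \<le> t" "t \<le> h"
    then show "((\<lambda>t. ?g ((p + s *\<^sub>R u) + t *\<^sub>R v)) has_real_derivative
        frechet_derivative ?g (at ((p + s *\<^sub>R u) + t *\<^sub>R v)) v) (at t)"
      using f'[OF S[of s t]] s by (intro along) auto
  qed
  then obtain t where t: "0 < t" "t < h" and
    2: "?g (p + s *\<^sub>R u + h *\<^sub>R v) - ?g (p + s *\<^sub>R u) =
      h * frechet_derivative ?g (at (p + s *\<^sub>R u + t *\<^sub>R v)) v"
    by auto
  show ?thesis
    using s t by (intro bexI[of _ s] bexI[of _ t]) (auto simp: 1 2)
qed

text \<open>On a small parallelogram at \<open>p\<close> one second difference equals h^2 times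
  either mixed derivative, each taken at some point of the parallelogram. These two values agree,
  and continuity puts each within e/2 of its value at \<open>p\<close>; hence the values at
  \<open>p\<close> differ by less than any positive e.\<close>

lemma frechet_derivative_commute:
  fixes f :: "'a::real_normed_vector \<Rightarrow> real"
  assumes "open S" "p \<in> S" and f: "higher_differentiable_on (Suc (Suc 0)) S f"
  shows "frechet_derivative (\<lambda>x. frechet_derivative f (at x) u) (at p) v =
    frechet_derivative (\<lambda>x. frechet_derivative f (at x) v) (at p) u"
proof (rule dense_eq0_I[of "_ - _", simplified])
  fix e :: real assume "0 < e"
  define D where "D u v x = frechet_derivative (\<lambda>x. frechet_derivative f (at x) u) (at x) v" for u v x
  have near: "\<exists>d>0. \<forall>x. dist x p < d \<longrightarrow> x \<in> S \<and> \<bar>D u v x - D u v p\<bar> < e / 2" for u v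
  proof -
    have "continuous_on S (D u v)"
      using f by (simp add: D_def[abs_def])
    then have "continuous (at p) (D u v)"
      using assms by (simp add: continuous_on_eq_continuous_at)
    then have "\<exists>d>0. \<forall>x. dist x p < d \<longrightarrow> \<bar>D u v x - D u v p\<bar> < e / 2"
      using \<open>0 < e\<close> unfolding continuous_at_eps_delta dist_real_def by (meson half_gt_zero)
    moreover obtain r where "r > 0" "ball p r \<subseteq> S"
      using assms by (meson openE)
    ultimately show ?thesis
      by (metis (no_types, lifting) dist_commute mem_ball min_less_iff_conj subset_iff)
  qed
  obtain d where "d > 0" and d: "\<And>x. dist x p < d \<Longrightarrow>
      x \<in> S \<and> \<bar>D u v x - D u v p\<bar> < e / 2 \<and> \<bar>D v u x - D v u p\<bar> < e / 2"
    using near[of u v] near[of v u] by (metis min_less_iff_conj)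
  \<comment> \<open>The summand 1 keeps \<open>N\<close> positive when \<open>u\<close> and
    \<open>v\<close> both vanish. With \<open>h\<close> equal to d / (2 N) every point of the
    parallelogram lies within d/2 of \<open>p\<close>.\<close>
  define N where "N = norm u + norm v + 1"
  define h where "h = d / (2 * N)"
  have pos: "N > 0" by (simp add: N_def add_nonneg_pos)
  then have h: "0 < h" using \<open>d > 0\<close> by (simp add: h_def)
  have close: "dist (p + s *\<^sub>R u + t *\<^sub>R v) p < d" if "s \<in> {0..h}" "t \<in> {0..h}" for s t
  proof -
    have "dist (p + s *\<^sub>R u + t *\<^sub>R v) p \<le> s * norm u + t * norm v"
      using that norm_triangle_ineq[of "s *\<^sub>R u" "t *\<^sub>R v"] by (simp add: dist_norm)
    also have "\<dots> \<le> h * norm u + h * norm v"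
      using that by (intro add_mono mult_right_mono) auto
    also have "\<dots> \<le> h * N" using h by (simp add: N_def algebra_simps)
    also have "\<dots> = d / 2" using pos by (simp add: h_def)
    also have "\<dots> < d" using \<open>d > 0\<close> by simp
    finally show ?thesis .
  qed
  have close': "dist (p + s *\<^sub>R v + t *\<^sub>R u) p < d" if "s \<in> {0..h}" "t \<in> {0..h}" for s t
    using close[OF that(2,1)] by (simp add: algebra_simps)
  have df: "\<And>x. x \<in> S \<Longrightarrow> f differentiable (at x)"
    "\<And>w x. x \<in> S \<Longrightarrow> (\<lambda>x. frechet_derivative f (at x) w) differentiable (at x)"
    using f by auto
  obtain s t where st: "s \<in> {0..h}" "t \<in> {0..h}"
    "f (p + h *\<^sub>R u + h *\<^sub>R v) - f (p + h *\<^sub>R u) - f (p + h *\<^sub>R v) + f p =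
      h * h * D u v (p + s *\<^sub>R u + t *\<^sub>R v)"
    using second_difference_mean_value[OF h close[THEN d, THEN conjunct1] df(1) df(2)[of _ u]]
    unfolding D_def by blast
  obtain s' t' where st': "s' \<in> {0..h}" "t' \<in> {0..h}"
    "f (p + h *\<^sub>R v + h *\<^sub>R u) - f (p + h *\<^sub>R v) - f (p + h *\<^sub>R u) + f p =
      h * h * D v u (p + s' *\<^sub>R v + t' *\<^sub>R u)"
    using second_difference_mean_value[OF h close'[THEN d, THEN conjunct1] df(1) df(2)[of _ v]]
    unfolding D_def by blast
  \<comment> \<open>Both orders lead to the same far corner, so the two formulas describe one second
    difference.\<close>
  have comm: "p + h *\<^sub>R v + h *\<^sub>R u = p + h *\<^sub>R u + h *\<^sub>R v" by (simp add: algebra_simps)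
  have "h * h * D u v (p + s *\<^sub>R u + t *\<^sub>R v) = h * h * D v u (p + s' *\<^sub>R v + t' *\<^sub>R u)"
    using st(3) st'(3)[unfolded comm] by linarith
  then have "D u v (p + s *\<^sub>R u + t *\<^sub>R v) = D v u (p + s' *\<^sub>R v + t' *\<^sub>R u)"
    using h by simp
  then have "\<bar>D u v p - D v u p\<bar> < e"
    using d[OF close[OF st(1,2)]] d[OF close'[OF st'(1,2)]] by argo
  then show "\<bar>frechet_derivative (\<lambda>x. frechet_derivative f (at x) u) (at p) v -
      frechet_derivative (\<lambda>x. frechet_derivative f (at x) v) (at p) u\<bar> \<le> e"
    by (simp add: D_def)
qed

lemma pd_commute:
  assumes "open S" "p \<in> S" "smooth_on S f"
  shows "pd a (pd b f) p = pd b (pd a f) p"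
  using frechet_derivative_commute[OF assms(1,2), of f "axis b 1" "axis a 1"] assms(3)
  unfolding smooth_on_def pd_def[abs_def] by blast

subsection \<open>Locally Lipschitz fields and uniqueness of integral curves\<close>

text \<open>Locality is essential: products of Lipschitz functions are in general Lipschitz only
  where the factors are bounded, and a small ball supplies that bound. The property is therefore
  closed under all operations that occur in \<open>lift_field\<close>.\<close>

definition lipschitz_near :: "'a::metric_space \<Rightarrow> ('a \<Rightarrow> 'b::metric_space) \<Rightarrow> bool" where
  "lipschitz_near q f \<longleftrightarrow> (\<exists>e>0. \<exists>L. L-lipschitz_on (ball q e) f)"

lemma lipschitz_near_const: "lipschitz_near q (\<lambda>_. c)"
  unfolding lipschitz_near_def
  using lipschitz_on_constant[of "ball q 1" c] zero_less_one by blast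

lemma lipschitz_near_bounded_linear:
  assumes "bounded_linear f"
  shows "lipschitz_near q f"
proof -
  obtain B where "B-lipschitz_on (ball q 1) f"
    using bounded_linear.lipschitz_boundE[OF assms] by blast
  then show ?thesis unfolding lipschitz_near_def by (meson zero_less_one)
qed

lemma lipschitz_near_common:
  assumes "lipschitz_near q f" "lipschitz_near q g"
  obtains e L M where "e > 0" "L-lipschitz_on (ball q e) f" "M-lipschitz_on (ball q e) g"
proof -
  obtain d L d' M where "d > 0" "L-lipschitz_on (ball q d) f" "d' > 0" "M-lipschitz_on (ball q d') g"
    using assms unfolding lipschitz_near_def by blast
  moreover have "ball q (min d d') \<subseteq> ball q d" "ball q (min d d') \<subseteq> ball q d'" by auto
  ultimately show thesis
    using that[of "min d d'" L M] lipschitz_on_subset by (metis min_less_iff_conj)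
qed

lemma lipschitz_near_add:
  fixes f g :: "'a::metric_space \<Rightarrow> 'b::real_normed_vector"
  assumes "lipschitz_near q f" "lipschitz_near q g"
  shows "lipschitz_near q (\<lambda>x. f x + g x)"
proof -
  obtain e L M where "e > 0" "L-lipschitz_on (ball q e) f" "M-lipschitz_on (ball q e) g"
    using lipschitz_near_common[OF assms] .
  then show ?thesis unfolding lipschitz_near_def by (blast intro: lipschitz_on_add)
qed

lemma lipschitz_near_minus:
  fixes f :: "'a::metric_space \<Rightarrow> 'b::real_normed_vector"
  assumes "lipschitz_near q f"
  shows "lipschitz_near q (\<lambda>x. - f x)"
  using assms unfolding lipschitz_near_def by simp

lemma lipschitz_near_diff:
  fixes f g :: "'a::metric_space \<Rightarrow> 'b::real_normed_vector"
  assumes "lipschitz_near q f" "lipschitz_near q g"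
  shows "lipschitz_near q (\<lambda>x. f x - g x)"
  using lipschitz_near_add[OF assms(1) lipschitz_near_minus[OF assms(2)]] by simp

lemma lipschitz_near_Pair:
  assumes "lipschitz_near q f" "lipschitz_near q g"
  shows "lipschitz_near q (\<lambda>x. (f x, g x))"
proof -
  obtain e L M where "e > 0" "L-lipschitz_on (ball q e) f" "M-lipschitz_on (ball q e) g"
    using lipschitz_near_common[OF assms] .
  then show ?thesis unfolding lipschitz_near_def by (blast intro: lipschitz_on_Pair)
qed

lemma lipschitz_near_sum:
  fixes f :: "'i \<Rightarrow> 'a::metric_space \<Rightarrow> 'b::real_normed_vector"
  assumes "\<And>i. i \<in> I \<Longrightarrow> lipschitz_near q (f i)"
  shows "lipschitz_near q (\<lambda>x. \<Sum>i\<in>I. f i x)"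
  using assms
  by (induction I rule: infinite_finite_induct) (auto intro: lipschitz_near_const lipschitz_near_add)

lemma lipschitz_near_compose:
  assumes f: "lipschitz_near q f" and g: "lipschitz_near (f q) g"
  shows "lipschitz_near q (\<lambda>x. g (f x))"
proof -
  obtain d L where d: "d > 0" and L: "L-lipschitz_on (ball q d) f"
    using f unfolding lipschitz_near_def by blast
  obtain e M where e: "e > 0" and M: "M-lipschitz_on (ball (f q) e) g"
    using g unfolding lipschitz_near_def by blast
  have "L \<ge> 0" using L lipschitz_on_nonneg by blast
  \<comment> \<open>The radius is shrunk so that \<open>f\<close> maps the ball into the domain
    where \<open>g\<close> is controlled; L + 1 in place of L avoids a zero denominator.\<close>
  define r where "r = min d (e / (L + 1))"
  have r: "r > 0" using d e \<open>L \<ge> 0\<close> by (simp add: r_def)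
  have "f ` ball q r \<subseteq> ball (f q) e"
  proof
    fix y assume "y \<in> f ` ball q r"
    then obtain x where x: "dist q x < d" "dist q x < e / (L + 1)" "y = f x"
      by (auto simp: r_def)
    have "dist (f q) y \<le> L * dist q x"
      using lipschitz_onD[OF L, of q x] x d by simp
    also have "\<dots> \<le> (L + 1) * dist q x" by (simp add: algebra_simps)
    also have "\<dots> < e" using x(2) \<open>L \<ge> 0\<close> by (simp add: field_simps)
    finally show "y \<in> ball (f q) e" by simp
  qed
  then have "M-lipschitz_on (f ` ball q r) g"
    using M lipschitz_on_subset by blast
  moreover have "L-lipschitz_on (ball q r) f"
    by (rule lipschitz_on_subset[OF L]) (auto simp: r_def)
  ultimately show ?thesis
    using r lipschitz_on_compose2 unfolding lipschitz_near_def by metis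
qed

lemma lipschitz_near_mult:
  fixes f g :: "'a::metric_space \<Rightarrow> real"
  assumes "lipschitz_near q f" "lipschitz_near q g"
  shows "lipschitz_near q (\<lambda>x. f x * g x)"
proof -
  obtain e L M where e: "e > 0" and f: "L-lipschitz_on (ball q e) f" and g: "M-lipschitz_on (ball q e) g"
    using lipschitz_near_common[OF assms] .
  have nonneg: "L \<ge> 0" "M \<ge> 0" using f g lipschitz_on_nonneg by blast+
  have bound: "\<bar>k x\<bar> \<le> \<bar>k q\<bar> + N * e" if "N-lipschitz_on (ball q e) k" "x \<in> ball q e"
    for k :: "'a \<Rightarrow> real" and N x
  proof -
    have "dist (k q) (k x) \<le> N * dist q x"
      using lipschitz_onD[OF that(1), of q x] that e by simp
    also have "\<dots> \<le> N * e"
      using that lipschitz_on_nonneg[OF that(1)] by (intro mult_left_mono) auto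
    finally show ?thesis by (simp add: dist_real_def)
  qed
  \<comment> \<open>On the ball, |f| is at most |f q| + L e and |g| is at most |g q| + M e; each
    bound multiplies the Lipschitz constant of the other factor.\<close>
  define A where "A = (\<bar>f q\<bar> + L * e) * M + (\<bar>g q\<bar> + M * e) * L"
  have "A-lipschitz_on (ball q e) (\<lambda>x. f x * g x)"
  proof (rule lipschitz_onI)
    fix x y assume xy: "x \<in> ball q e" "y \<in> ball q e"
    have "\<bar>f x * g x - f y * g y\<bar> = \<bar>f x * (g x - g y) + g y * (f x - f y)\<bar>"
      by (simp add: algebra_simps)
    also have "\<dots> \<le> \<bar>f x\<bar> * \<bar>g x - g y\<bar> + \<bar>g y\<bar> * \<bar>f x - f y\<bar>"
      by (metis abs_mult abs_triangle_ineq)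
    also have "\<dots> \<le> (\<bar>f q\<bar> + L * e) * (M * dist x y) + (\<bar>g q\<bar> + M * e) * (L * dist x y)"
      using bound[OF f xy(1)] bound[OF g xy(2)] lipschitz_onD[OF f xy] lipschitz_onD[OF g xy]
        nonneg e by (intro add_mono mult_mono) (auto simp: dist_real_def)
    finally show "dist (f x * g x) (f y * g y) \<le> A * dist x y"
      by (simp add: A_def dist_real_def algebra_simps)
  qed (use nonneg e in \<open>simp add: A_def\<close>)
  with e show ?thesis unfolding lipschitz_near_def by blast
qed

text \<open>Writing the vector as a sum of multiples of the axis vectors reduces it to
  \<open>lipschitz_near_sum\<close>, each component being followed by a bounded linear map.\<close>

lemma lipschitz_near_vec:
  fixes f :: "'i::finite \<Rightarrow> 'a::metric_space \<Rightarrow> real"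
  assumes "\<And>i. lipschitz_near q (f i)"
  shows "lipschitz_near q (\<lambda>x. \<chi> i. f i x)"
proof -
  have "lipschitz_near q (\<lambda>x. \<Sum>i\<in>UNIV. f i x *\<^sub>R (axis i 1 :: real^'i))"
    by (intro lipschitz_near_sum lipschitz_near_compose[OF assms]
        lipschitz_near_bounded_linear bounded_linear_scaleR_left)
  moreover have "(\<Sum>i\<in>UNIV. f i x *\<^sub>R axis i 1) = (\<chi> i. f i x)" for x
    using basis_expansion[of "\<chi> i. f i x"] by (simp add: scalar_mult_eq_scaleR)
  ultimately show ?thesis by simp
qed

lemma lipschitz_near_cong:
  assumes "open S" "q \<in> S" "\<And>x. x \<in> S \<Longrightarrow> f x = g x" "lipschitz_near q f"
  shows "lipschitz_near q g"
proof -
  obtain d where d: "d > 0" "ball q d \<subseteq> S" using assms(1,2) by (meson openE)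
  obtain e L where e: "e > 0" "L-lipschitz_on (ball q e) f"
    using assms(4) unfolding lipschitz_near_def by blast
  have "L-lipschitz_on (ball q (min d e)) f"
    by (rule lipschitz_on_subset[OF e(2)]) auto
  then have "L-lipschitz_on (ball q (min d e)) g"
    by (rule lipschitz_on_transform) (use d assms(3) in auto)
  then show ?thesis using d(1) e(1) unfolding lipschitz_near_def by (metis min_less_iff_conj)
qed

text \<open>The derivative is bounded on a compact ball inside \<open>S\<close>, and the mean value
  inequality on this convex set turns the bound into a Lipschitz constant.\<close>

lemma smooth_on_imp_lipschitz_near:
  fixes f :: "'a::euclidean_space \<Rightarrow> 'b::real_normed_vector"
  assumes "open S" "q \<in> S" and f: "smooth_on S f"
  shows "lipschitz_near q f"
proof -
  obtain r where r: "r > 0" "cball q r \<subseteq> S"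
    using assms(1,2) open_contains_cball by metis
  \<comment> \<open>Smoothness gives continuity of the derivative in each fixed direction. The sum
    over the basis is continuous as well, and it dominates the operator norm.\<close>
  have "continuous_on S (\<lambda>x. \<Sum>b\<in>Basis. norm (frechet_derivative f (at x) b))"
    using smooth_on_continuous_on[OF smooth_on_frechet_derivative[OF f]]
    by (intro continuous_intros) auto
  then have "compact ((\<lambda>x. \<Sum>b\<in>Basis. norm (frechet_derivative f (at x) b)) ` cball q r)"
    using r(2) continuous_on_subset by (intro compact_continuous_image) auto
  then have "bdd_above ((\<lambda>x. \<Sum>b\<in>Basis. norm (frechet_derivative f (at x) b)) ` cball q r)"
    by (intro bounded_imp_bdd_above compact_imp_bounded)
  then obtain B where B: "\<And>x. x \<in> cball q r \<Longrightarrow> (\<Sum>b\<in>Basis. norm (frechet_derivative f (at x) b)) \<le> B"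
    unfolding bdd_above_def by blast
  have D: "(f has_derivative frechet_derivative f (at x)) (at x)" if "x \<in> S" for x
    using smooth_on_differentiable[OF f that] by (simp add: frechet_derivative_works)
  have onorm: "onorm (frechet_derivative f (at x)) \<le> B" if x: "x \<in> cball q r" for x
  proof (rule onorm_le)
    fix v
    have lin: "linear (frechet_derivative f (at x))"
      by (rule has_derivative_linear[OF D]) (use x r(2) in blast)
    have "frechet_derivative f (at x) v = (\<Sum>b\<in>Basis. (v \<bullet> b) *\<^sub>R frechet_derivative f (at x) b)"
      using arg_cong[OF euclidean_representation[of v], of "frechet_derivative f (at x)"]
      by (simp add: linear_sum[OF lin] linear_cmul[OF lin])
    also have "norm \<dots> \<le> (\<Sum>b\<in>Basis. norm v * norm (frechet_derivative f (at x) b))"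
      by (intro sum_norm_le) (simp add: Basis_le_norm mult_right_mono)
    also have "\<dots> \<le> B * norm v"
      using mult_left_mono[OF B[OF x], of "norm v"]
      by (simp add: sum_distrib_left[symmetric] mult.commute)
    finally show "norm (frechet_derivative f (at x) v) \<le> B * norm v" .
  qed
  have "B \<ge> 0"
    using B[of q] r(1) by (smt (verit) centre_in_cball norm_ge_zero sum_nonneg)
  have "B-lipschitz_on (cball q r) f"
  proof (rule lipschitz_onI[OF _ \<open>B \<ge> 0\<close>])
    fix x y assume "x \<in> cball q r" "y \<in> cball q r"
    then show "dist (f x) (f y) \<le> B * dist x y"
      unfolding dist_norm
      by (rule differentiable_bound[OF convex_cball has_derivative_at_withinI[OF D] onorm, rotated -2])
        (use r(2) in blast)+
  qed
  then show ?thesis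
    using r(1) lipschitz_on_subset[OF _ ball_subset_cball] unfolding lipschitz_near_def by metis
qed

section \<open>Uniqueness of integral curves by a Gronwall estimate\<close>

lemma gronwall_zero:
  fixes w :: "real \<Rightarrow> real"
  assumes w: "\<And>t. t \<in> {a..b} \<Longrightarrow> (w has_real_derivative w' t) (at t)"
    and K: "\<And>t. t \<in> {a..b} \<Longrightarrow> \<bar>w' t\<bar> \<le> K * w t"
    and nonneg: "\<And>t. 0 \<le> w t"
    and c: "c \<in> {a..b}" "w c = 0" and t: "t \<in> {a..b}"
  shows "w t = 0"
proof (cases "c \<le> t")
  case True
  \<comment> \<open>The integrating factor exp(-K s) makes the product nonincreasing forward from
    \<open>c\<close>, where it vanishes; nonnegativity of \<open>w\<close> then forces the value 0.
    The other case runs backward in time with exp(K s).\<close>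
  have "w t * exp (- K * t) \<le> w c * exp (- K * c)"
  proof (rule DERIV_nonpos_imp_nonincreasing[OF True])
    fix s assume s: "c \<le> s" "s \<le> t"
    have "((\<lambda>s. w s * exp (- K * s)) has_real_derivative (w' s - K * w s) * exp (- K * s)) (at s)"
      using w[of s] s c t by (auto intro!: derivative_eq_intros simp: algebra_simps)
    moreover have "(w' s - K * w s) * exp (- K * s) \<le> 0"
      using K[of s] s c t by (intro mult_nonpos_nonneg) auto
    ultimately show "\<exists>y. ((\<lambda>s. w s * exp (- K * s)) has_real_derivative y) (at s) \<and> y \<le> 0" by blast
  qed
  then show ?thesis using c(2) nonneg[of t] by (simp add: mult_le_0_iff)
next
  case False
  then have "t \<le> c" by simp
  have "w t * exp (K * t) \<le> w c * exp (K * c)"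
  proof (rule DERIV_nonneg_imp_nondecreasing[OF \<open>t \<le> c\<close>])
    fix s assume s: "t \<le> s" "s \<le> c"
    have "((\<lambda>s. w s * exp (K * s)) has_real_derivative (w' s + K * w s) * exp (K * s)) (at s)"
      using w[of s] s c t by (auto intro!: derivative_eq_intros simp: algebra_simps)
    moreover have "(w' s + K * w s) * exp (K * s) \<ge> 0"
      using K[of s] s c t by (intro mult_nonneg_nonneg) auto
    ultimately show "\<exists>y. ((\<lambda>s. w s * exp (K * s)) has_real_derivative y) (at s) \<and> 0 \<le> y" by blast
  qed
  then show ?thesis using c(2) nonneg[of t] by (simp add: mult_le_0_iff)
qed

text \<open>The set of times at which the curves agree is closed in the interval J \<inter> I by
  continuity and open by the Gronwall estimate, so by connectedness it is the whole interval. A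
  Lipschitz constant is available only near each point, hence the open-closed argument in place of a
  single estimate.\<close>

lemma integral_curve_unique:
  fixes X :: "'a::real_inner \<Rightarrow> 'a"
  assumes X: "\<And>q. q \<in> M \<Longrightarrow> lipschitz_near q X"
    and \<gamma>: "integral_curve M X J \<gamma>" and \<delta>: "integral_curve M X I \<delta>"
    and c: "c \<in> J" "c \<in> I" "\<gamma> c = \<delta> c" and t: "t \<in> J" "t \<in> I"
  shows "\<gamma> t = \<delta> t"
proof -
  let ?K = "J \<inter> I"
  define S where "S = {t \<in> ?K. \<gamma> t - \<delta> t = 0}"
  have d\<gamma>: "(\<gamma> has_vector_derivative X (\<gamma> t)) (at t)" and M: "\<gamma> t \<in> M" if "t \<in> J" for t
    using \<gamma> that unfolding integral_curve_def by auto
  have d\<delta>: "(\<delta> has_vector_derivative X (\<delta> t)) (at t)" if "t \<in> I" for t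
    using \<delta> that unfolding integral_curve_def by auto
  have opn: "open ?K" and "is_interval ?K"
    using \<gamma> \<delta> unfolding integral_curve_def by (auto intro: is_interval_Int)
  then have con: "connected ?K" by (simp add: is_interval_connected_1)
  have cont: "isCont \<gamma> t" "isCont \<delta> t" if "t \<in> ?K" for t
    using that d\<gamma> d\<delta> has_vector_derivative_continuous by blast+
  then have "continuous_on ?K (\<lambda>t. \<gamma> t - \<delta> t)"
    by (intro continuous_intros) (simp_all add: continuous_at_imp_continuous_on)
  then have "closedin (top_of_set ?K) S"
    unfolding S_def by (rule continuous_closedin_preimage_constant)
  moreover have "open S"
  proof (unfold open_contains_ball, rule ballI)
    fix s assume "s \<in> S"
    then have s: "s \<in> J" "s \<in> I" "\<gamma> s = \<delta> s" by (auto simp: S_def)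
    obtain e L where e: "e > 0" and L: "L-lipschitz_on (ball (\<gamma> s) e) X"
      using X[OF M[OF s(1)]] unfolding lipschitz_near_def by blast
    have "(\<gamma> \<longlongrightarrow> \<gamma> s) (nhds s)" "(\<delta> \<longlongrightarrow> \<gamma> s) (nhds s)"
      using cont[of s] s tendsto_at_iff_tendsto_nhds[of \<gamma> s] tendsto_at_iff_tendsto_nhds[of \<delta> s]
      by (auto simp: isCont_def)
    then have "\<forall>\<^sub>F t in nhds s. \<gamma> t \<in> ball (\<gamma> s) e" "\<forall>\<^sub>F t in nhds s. \<delta> t \<in> ball (\<gamma> s) e"
      using e by (auto intro: topological_tendstoD simp del: mem_ball)
    moreover have "\<forall>\<^sub>F t in nhds s. t \<in> ?K"
      using opn s by (intro eventually_nhds_in_open) auto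
    ultimately have "\<forall>\<^sub>F t in nhds s. \<gamma> t \<in> ball (\<gamma> s) e \<and> \<delta> t \<in> ball (\<gamma> s) e \<and> t \<in> ?K"
      by (intro eventually_conj)
    then obtain r where r: "r > 0" and *: "\<And>t. dist t s < r \<Longrightarrow>
        \<gamma> t \<in> ball (\<gamma> s) e \<and> \<delta> t \<in> ball (\<gamma> s) e \<and> t \<in> ?K"
      unfolding eventually_nhds_metric by blast
    \<comment> \<open>The squared distance stays differentiable where the curves meet, unlike the
      distance itself in general. Cauchy-Schwarz and the local constant \<open>L\<close> bound its
      derivative by 2 L times itself.\<close>
    let ?w = "\<lambda>t. (\<gamma> t - \<delta> t) \<bullet> (\<gamma> t - \<delta> t)"
    let ?w' = "\<lambda>t. 2 * ((\<gamma> t - \<delta> t) \<bullet> (X (\<gamma> t) - X (\<delta> t)))"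
    \<comment> \<open>With half the radius, the closed interval required by
      \<open>gronwall_zero\<close> lies in the open ball of radius \<open>r\<close>.\<close>
    have w0: "?w t = 0" if t: "t \<in> {s - r / 2..s + r / 2}" for t
    proof (rule gronwall_zero[where w' = ?w' and K = "2 * L", OF _ _ _ _ _ t])
      fix u assume "u \<in> {s - r / 2..s + r / 2}"
      then have u: "\<gamma> u \<in> ball (\<gamma> s) e" "\<delta> u \<in> ball (\<gamma> s) e" "u \<in> J" "u \<in> I"
        using *[of u] r by (auto simp: dist_real_def)
      have "((\<lambda>t. \<gamma> t - \<delta> t) has_derivative (\<lambda>d. d *\<^sub>R (X (\<gamma> u) - X (\<delta> u)))) (at u)"
        using has_vector_derivative_diff[OF d\<gamma>[OF u(3)] d\<delta>[OF u(4)]]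
        by (simp add: has_vector_derivative_def)
      from has_derivative_inner[OF this this]
      show "(?w has_real_derivative ?w' u) (at u)"
        unfolding has_field_derivative_def
        by (rule has_derivative_eq_rhs) (auto simp: fun_eq_iff inner_commute)
      have "\<bar>(\<gamma> u - \<delta> u) \<bullet> (X (\<gamma> u) - X (\<delta> u))\<bar> \<le> norm (\<gamma> u - \<delta> u) * norm (X (\<gamma> u) - X (\<delta> u))"
        by (rule Cauchy_Schwarz_ineq2)
      also have "\<dots> \<le> norm (\<gamma> u - \<delta> u) * (L * norm (\<gamma> u - \<delta> u))"
        using lipschitz_onD[OF L u(1,2)] by (intro mult_left_mono) (auto simp: dist_norm)
      finally show "\<bar>?w' u\<bar> \<le> 2 * L * ?w u"
        by (simp add: abs_mult power2_norm_eq_inner[symmetric] power2_eq_square mult_ac)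
    qed (use r s in auto)
    have "ball s (r / 2) \<subseteq> S"
    proof
      fix u assume "u \<in> ball s (r / 2)"
      then have "dist u s < r" "u \<in> {s - r / 2..s + r / 2}"
        using r by (auto simp: dist_real_def abs_if field_simps split: if_splits)
      then show "u \<in> S" using *[of u] w0[of u] by (simp add: S_def)
    qed
    then show "\<exists>d>0. ball s d \<subseteq> S"
      using r half_gt_zero by blast
  qed
  then have "openin (top_of_set ?K) S"
    by (auto simp: S_def intro: open_subset)
  moreover have "c \<in> S" using c by (simp add: S_def)
  ultimately have "S = ?K" using con connected_clopen by blast
  then show ?thesis using t unfolding S_def by auto
qed

subsection \<open>Contact Hamiltonian fields and the lifted field\<close>

lemma coord_simps [simp]:
  "p_coord (x, xn, p, pn, z) = p" "pn_coord (x, xn, p, pn, z) = pn" "xn_coord (x, xn, p, pn, z) = xn"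
  by (simp_all add: p_coord_def pn_coord_def xn_coord_def)

lemma bounded_linear_projections:
  "bounded_linear (p_coord :: 'n::finite extended \<Rightarrow> _)"
  "bounded_linear (pn_coord :: 'n::finite extended \<Rightarrow> _)"
  "bounded_linear (xn_coord :: 'n::finite extended \<Rightarrow> _)"
  unfolding p_coord_def pn_coord_def xn_coord_def case_prod_beta
  by (intro bounded_linear_fst_comp bounded_linear_snd_comp bounded_linear_ident)+

section \<open>Differentials in the extended coordinates\<close>

lemma has_derivative_fst_snd_comp:
  assumes "f differentiable (at p)"
  shows "((\<lambda>q. f (fst (snd (snd q)))) has_derivative (\<lambda>v. grad f p \<bullet> fst (snd (snd v))))
    (at (x, xn, p, y))"
proof -
  have "((\<lambda>q. fst (snd (snd q))) has_derivative (\<lambda>v. fst (snd (snd v)))) (at (x, xn, p, y))"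
    by (intro derivative_intros)
  from has_derivative_compose[OF this, of f] has_derivative_grad[OF assms]
  show ?thesis by simp
qed

lemma Delta_has_derivative:
  assumes "pd a \<phi> differentiable (at p)"
  shows "(Delta \<phi> x0 a has_derivative (\<lambda>(dx, dxn, dp, dpn, dz).
      dx $ a - dxn / x0 * pd a \<phi> p - xn / x0 * (grad (pd a \<phi>) p \<bullet> dp))) (at (x, xn, p, pn, z))"
  unfolding Delta_def case_prod_beta divide_inverse
  by (auto intro!: derivative_eq_intros has_derivative_fst_snd_comp[OF assms]
      bounded_linear.has_derivative[OF bounded_linear_vec_nth] simp: fun_eq_iff algebra_simps)

lemma sum_mult_inner: "(\<Sum>i\<in>UNIV. x $ i * y $ i) = x \<bullet> (y :: real^'n::finite)"
  by (simp add: inner_vec_def)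

lemma Delta0_has_derivative:
  assumes "\<phi> differentiable (at p)"
  shows "(Delta0 \<phi> x0 has_derivative (\<lambda>(dx, dxn, dp, dpn, dz).
      dx \<bullet> p + x \<bullet> dp + dxn * pn + (xn - x0) * dpn - grad \<phi> p \<bullet> dp - dz)) (at (x, xn, p, pn, z))"
  unfolding Delta0_def case_prod_beta sum_mult_inner
  by (auto intro!: derivative_eq_intros has_derivative_fst_snd_comp[OF assms] simp: fun_eq_iff)

lemma has_derivative_contact_form:
  "((\<lambda>q. contact_form q (dx, dxn, dp, dpn, dz)) has_derivative
    (\<lambda>u. - (fst (snd (snd u)) \<bullet> dx) - fst (snd (snd (snd u))) * dxn)) (at q)"
  unfolding contact_form_def case_prod_beta sum_mult_inner
  by (auto intro!: derivative_eq_intros simp: fun_eq_iff)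

text \<open>Testing the two-form identity on the coordinate directions determines every component of
  \<open>V\<close> but the last: the dz-terms cancel, since \<open>E\<close> is the z-derivative of
  \<open>h\<close>. The last component is then fixed by the value of the contact form.\<close>

lemma contact_hamiltonian_coordinates:
  fixes A C :: "real^'n::finite" and q :: "'n extended"
  assumes q: "q = (x, xn, p, pn, z)"
    and h: "(h has_derivative
      (\<lambda>(dx, dxn, dp, dpn, dz). A \<bullet> dx + B * dxn + C \<bullet> dp + D * dpn + E * dz)) (at q)"
  shows "contact_form q V = h q \<and>
      (\<forall>v. ext_deriv contact_form q V v =
        - (frechet_derivative h (at q) v - pd_z h q * contact_form q v)) \<longleftrightarrow>
    V = (- C, - D, A + E *\<^sub>R p, B + E * pn, h q - C \<bullet> p - D * pn)"
proof -
  obtain X XN Q QN Z where V: "V = (X, XN, Q, QN, Z)" by (metis prod_cases5)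
  have cf: "contact_form q (dx, dxn, dp, dpn, dz) = dz - p \<bullet> dx - pn * dxn" for dx dxn dp dpn dz
    by (simp add: q contact_form_def sum_mult_inner)
  have dh: "frechet_derivative h (at q) =
      (\<lambda>(dx, dxn, dp, dpn, dz). A \<bullet> dx + B * dxn + C \<bullet> dp + D * dpn + E * dz)"
    using frechet_derivative_at[OF h] by simp
  have ext: "ext_deriv contact_form q V (dx, dxn, dp, dpn, dz) =
      - (Q \<bullet> dx) - QN * dxn + dp \<bullet> X + dpn * XN" for dx dxn dp dpn dz
    unfolding ext_deriv_def V
    by (simp add: frechet_derivative_at[OF has_derivative_contact_form, symmetric])
  let ?eq = "\<lambda>dx dxn dp dpn. - (Q \<bullet> dx) - QN * dxn + dp \<bullet> X + dpn * XN =
      - (A \<bullet> dx + B * dxn + C \<bullet> dp + D * dpn) - E * (p \<bullet> dx + pn * dxn)"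
  have "(\<forall>v. ext_deriv contact_form q V v =
        - (frechet_derivative h (at q) v - pd_z h q * contact_form q v)) \<longleftrightarrow>
      (\<forall>dx dxn dp dpn. ?eq dx dxn dp dpn)"
    by (simp add: split_paired_all split_paired_All ext pd_z_def dh cf algebra_simps)
  also have "\<dots> \<longleftrightarrow> X = - C \<and> XN = - D \<and> Q = A + E *\<^sub>R p \<and> QN = B + E * pn"
  proof
    assume eq: "\<forall>dx dxn dp dpn. ?eq dx dxn dp dpn"
    have "X \<bullet> dp = (- C) \<bullet> dp" for dp
      using eq[rule_format, of 0 0 dp 0] by (simp add: inner_commute)
    then have "X = - C" using vector_eq_rdot by blast
    moreover have "Q \<bullet> dx = (A + E *\<^sub>R p) \<bullet> dx" for dx
      using eq[rule_format, of dx 0 0 0] by (simp add: inner_add_left)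
    then have "Q = A + E *\<^sub>R p" using vector_eq_rdot by blast
    ultimately show "X = - C \<and> XN = - D \<and> Q = A + E *\<^sub>R p \<and> QN = B + E * pn"
      using eq[rule_format, of 0 0 0 1] eq[rule_format, of 0 1 0 0] by simp
  qed (auto simp: inner_add_left inner_commute algebra_simps)
  finally show ?thesis
    by (auto simp: V cf inner_commute mult.commute)
qed

text \<open>The \<open>p\<close>-gradient of the Hamiltonian \<open>lift_hamiltonian \<phi> x0 F \<Gamma>\<close>.\<close>

definition lift_covector ::
    "(real^'n::finite \<Rightarrow> real) \<Rightarrow> real \<Rightarrow> ('n \<Rightarrow> real^'n \<Rightarrow> real) \<Rightarrow> (real \<Rightarrow> real) \<Rightarrow>
      'n extended \<Rightarrow> real^'n" where
  "lift_covector \<phi> x0 F \<Gamma> = (\<lambda>(x, xn, p, pn, z).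
     (\<Sum>i\<in>UNIV. Delta \<phi> x0 i (x, xn, p, pn, z) *\<^sub>R grad (F i) p)
     - (xn / x0) *\<^sub>R (\<Sum>i\<in>UNIV. F i p *\<^sub>R grad (pd i \<phi>) p)
     + deriv \<Gamma> (Delta0 \<phi> x0 (x, xn, p, pn, z)) *\<^sub>R (x - grad \<phi> p))"

text \<open>Puts the field into the shape produced by
  \<open>contact_hamiltonian_coordinates\<close>: the double sums in the z-component are gradients
  paired with \<open>p\<close>, and they collect into the pairing of \<open>lift_covector\<close>
  with \<open>p\<close>.\<close>

lemma lift_field_eq:
  fixes q :: "'n::finite extended"
  assumes q: "q = (x, xn, p, pn, z)"
  shows "lift_field \<phi> x0 F \<Gamma> q =
    (- lift_covector \<phi> x0 F \<Gamma> q, deriv \<Gamma> (Delta0 \<phi> x0 q) * (x0 - xn), (\<chi> a. F a p),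
     - (1 / x0) * (\<Sum>i\<in>UNIV. pd i \<phi> p * F i p),
     lift_hamiltonian \<phi> x0 F \<Gamma> q - lift_covector \<phi> x0 F \<Gamma> q \<bullet> p
       + deriv \<Gamma> (Delta0 \<phi> x0 q) * (x0 - xn) * pn)"
proof -
  have 1: "(\<Sum>i\<in>UNIV. \<Sum>a\<in>UNIV. p $ i * pd i (pd a \<phi>) p * F a p) =
      (\<Sum>a\<in>UNIV. F a p * (grad (pd a \<phi>) p \<bullet> p))"
    by (subst sum.swap) (simp add: inner_vec_def grad_def sum_distrib_left mult_ac)
  have 2: "(\<Sum>i\<in>UNIV. \<Sum>a\<in>UNIV. p $ i * Delta \<phi> x0 a q * pd i (F a) p) =
      (\<Sum>a\<in>UNIV. Delta \<phi> x0 a q * (grad (F a) p \<bullet> p))"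
    by (subst sum.swap) (simp add: inner_vec_def grad_def sum_distrib_left mult_ac)
  have 3: "(\<Sum>i\<in>UNIV. p $ i * pd i \<phi> p) = grad \<phi> p \<bullet> p"
    by (simp add: inner_vec_def grad_def mult.commute)
  show ?thesis
    unfolding q lift_field_def Let_def case_prod_conv 1[unfolded q] 2[unfolded q] 3 sum_mult_inner
    by (simp add: lift_covector_def lift_hamiltonian_def p_coord_def vec_eq_iff grad_def[of \<phi>]
        inner_add_left inner_diff_left inner_sum_left sum_component algebra_simps)
      (simp add: grad_def algebra_simps)
qed

text \<open>The differential is sorted so as to expose the coefficients A to E of
  \<open>contact_hamiltonian_coordinates\<close>. The dz-coefficient E is minus the derivative of
  \<Gamma> because \<open>Delta0\<close> contains -z; in A + E p it removes the contribution of
  \<Gamma> and leaves \<open>F\<close>.\<close>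

lemma lift_hamiltonian_has_derivative:
  fixes q :: "'n::finite extended"
  assumes q: "q = (x, xn, p, pn, z)"
    and \<phi>: "\<phi> differentiable (at p)" "\<And>a. pd a \<phi> differentiable (at p)"
    and F: "\<And>a. F a differentiable (at p)"
    and \<Gamma>: "\<Gamma> differentiable (at (Delta0 \<phi> x0 q))"
  shows "(lift_hamiltonian \<phi> x0 F \<Gamma> has_derivative (\<lambda>(dx, dxn, dp, dpn, dz).
      ((\<chi> a. F a p) + deriv \<Gamma> (Delta0 \<phi> x0 q) *\<^sub>R p) \<bullet> dx
      + (deriv \<Gamma> (Delta0 \<phi> x0 q) * pn - (1 / x0) * (\<Sum>i\<in>UNIV. pd i \<phi> p * F i p)) * dxn
      + lift_covector \<phi> x0 F \<Gamma> q \<bullet> dp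
      + deriv \<Gamma> (Delta0 \<phi> x0 q) * (xn - x0) * dpn
      + (- deriv \<Gamma> (Delta0 \<phi> x0 q)) * dz)) (at q)"
proof -
  have \<Gamma>': "(\<Gamma> has_derivative (\<lambda>d. deriv \<Gamma> (Delta0 \<phi> x0 q) * d)) (at (Delta0 \<phi> x0 q))"
    using \<Gamma> by (simp add: DERIV_deriv_iff_real_differentiable has_field_derivative_imp_has_derivative)
  note dF = has_derivative_fst_snd_comp[OF F]
  have d: "((\<lambda>q. (\<Sum>a\<in>UNIV. Delta \<phi> x0 a q * F a (fst (snd (snd q)))) + \<Gamma> (Delta0 \<phi> x0 q))
    has_derivative (\<lambda>v. (\<Sum>a\<in>UNIV. Delta \<phi> x0 a q * (grad (F a) p \<bullet> fst (snd (snd v)))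
      + (case v of (dx, dxn, dp, dpn, dz) \<Rightarrow>
          dx $ a - dxn / x0 * pd a \<phi> p - xn / x0 * (grad (pd a \<phi>) p \<bullet> dp)) * F a p)
      + deriv \<Gamma> (Delta0 \<phi> x0 q) * (case v of (dx, dxn, dp, dpn, dz) \<Rightarrow>
          dx \<bullet> p + x \<bullet> dp + dxn * pn + (xn - x0) * dpn - grad \<phi> p \<bullet> dp - dz))) (at q)"
    unfolding q
    by (intro has_derivative_add has_derivative_sum
        has_derivative_mult[OF Delta_has_derivative[OF \<phi>(2)] dF, unfolded fst_conv snd_conv]
        has_derivative_compose[OF Delta0_has_derivative[OF \<phi>(1)] \<Gamma>'[unfolded q]])
  have h: "lift_hamiltonian \<phi> x0 F \<Gamma> =
      (\<lambda>q. (\<Sum>a\<in>UNIV. Delta \<phi> x0 a q * F a (fst (snd (snd q)))) + \<Gamma> (Delta0 \<phi> x0 q))"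
    by (simp add: fun_eq_iff lift_hamiltonian_def p_coord_def case_prod_beta)
  have F_inner: "(\<chi> a. F a p) \<bullet> dx = (\<Sum>a\<in>UNIV. F a p * dx $ a)" for dx
    by (simp add: inner_vec_def)
  show ?thesis
    unfolding h
    by (rule has_derivative_eq_rhs[OF d])
      (auto simp: fun_eq_iff lift_covector_def q F_inner inner_commute[of p] inner_add_left
        inner_diff_left inner_sum_left sum.distrib sum_subtractf sum_distrib_left sum_distrib_right
        algebra_simps)
qed

text \<open>A statement about one tangent vector, free of curves: the left sides of the last two
  equations are the differentials of \<open>Delta \<phi> x0 a\<close> and
  \<open>Delta0 \<phi> x0\<close> applied to it. Symmetry of the Hessian enters because the
  differential of \<open>Delta\<close> differentiates \<open>pd a \<phi>\<close> along
  \<open>F\<close>, while \<open>lift_field\<close> differentiates \<open>pd i \<phi>\<close> in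
  direction \<open>a\<close>.\<close>

lemma lift_field_iff:
  fixes q :: "'n::finite extended"
  assumes q: "q = (x, xn, p, pn, z)" and x0: "x0 \<noteq> 0"
    and sym: "\<And>a i. pd a (pd i \<phi>) p = pd i (pd a \<phi>) p"
  shows "(dx, dxn, dp, dpn, dz) = lift_field \<phi> x0 F \<Gamma> q \<longleftrightarrow>
    (\<forall>a. dp $ a = F a p) \<and> dpn = - (1 / x0) * (\<Sum>i\<in>UNIV. pd i \<phi> p * F i p) \<and>
    dxn = deriv \<Gamma> (Delta0 \<phi> x0 q) * (x0 - xn) \<and>
    (\<forall>a. dx $ a - dxn / x0 * pd a \<phi> p - xn / x0 * (grad (pd a \<phi>) p \<bullet> dp) =
      - (\<Sum>i\<in>UNIV. pd a (F i) p * Delta \<phi> x0 i q) - deriv \<Gamma> (Delta0 \<phi> x0 q) * Delta \<phi> x0 a q) \<and>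
    dx \<bullet> p + x \<bullet> dp + dxn * pn + (xn - x0) * dpn - grad \<phi> p \<bullet> dp - dz = - \<Gamma> (Delta0 \<phi> x0 q)"
    (is "_ \<longleftrightarrow> ?dp \<and> ?dpn \<and> ?dxn \<and> ?D \<and> ?Z")
proof (cases "?dp \<and> ?dpn \<and> ?dxn")
  \<comment> \<open>Once dp, dpn and dxn have their prescribed values, the two remaining conditions
    can be solved for dx and dz. In the other case both sides are false.\<close>
  case True
  let ?C = "lift_covector \<phi> x0 F \<Gamma> q" and ?G = "deriv \<Gamma> (Delta0 \<phi> x0 q)"
  have dp: "dp = (\<chi> a. F a p)" using True by (simp add: vec_eq_iff)
  have C: "?C $ a = (\<Sum>i\<in>UNIV. pd a (F i) p * Delta \<phi> x0 i q)
      - xn / x0 * (grad (pd a \<phi>) p \<bullet> dp) + ?G * (x $ a - pd a \<phi> p)" for a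
    using sym[of a]
    by (simp add: lift_covector_def q dp inner_vec_def grad_def sum_component mult.commute)
  have \<Delta>: "Delta \<phi> x0 a q = x $ a - xn / x0 * pd a \<phi> p" for a
    by (simp add: Delta_def q)
  have "?D \<longleftrightarrow> (\<forall>a. dx $ a = (- ?C) $ a)"
  proof (intro all_cong1)
    fix a
    \<comment> \<open>This is the contribution of dxn to the differential of \<open>Delta\<close>:
      its first part cancels the summand with \<open>pd a \<phi>\<close> in dx, and the rest
      completes \<open>x $ a\<close> to \<open>Delta\<close>.\<close>
    have "?G * (x0 - xn) / x0 * pd a \<phi> p = ?G * pd a \<phi> p - ?G * (xn / x0 * pd a \<phi> p)"
      using x0 by (simp add: field_simps)
    then show "(dx $ a - dxn / x0 * pd a \<phi> p - xn / x0 * (grad (pd a \<phi>) p \<bullet> dp) =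
      - (\<Sum>i\<in>UNIV. pd a (F i) p * Delta \<phi> x0 i q) - ?G * Delta \<phi> x0 a q) \<longleftrightarrow> dx $ a = (- ?C) $ a"
      using True by (simp add: C \<Delta>[of a] right_diff_distrib) argo
  qed
  then have D: "?D \<longleftrightarrow> dx = - ?C" by (simp add: vec_eq_iff)
  have dpn: "dpn = - (1 / x0) * (grad \<phi> p \<bullet> dp)"
    using True by (simp add: dp inner_vec_def grad_def)
  have "lift_hamiltonian \<phi> x0 F \<Gamma> q = x \<bullet> dp - xn / x0 * (grad \<phi> p \<bullet> dp) + \<Gamma> (Delta0 \<phi> x0 q)"
    by (simp add: lift_hamiltonian_def \<Delta>[unfolded q] q dp inner_vec_def grad_def sum_subtractf
        sum_distrib_left algebra_simps)
  \<comment> \<open>Inserting dpn cancels the last \<open>grad \<phi> p\<close> term in the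
    differential of \<open>Delta0\<close> and leaves the sum of \<open>Delta\<close> times
    \<open>F\<close>. Condition \<open>?Z\<close> thereby says that the contact form takes the value
    of \<open>lift_hamiltonian\<close> on the vector.\<close>
  moreover have "(xn - x0) * dpn = - xn / x0 * (grad \<phi> p \<bullet> dp) + grad \<phi> p \<bullet> dp"
    using x0 by (simp add: dpn field_simps)
  ultimately have D0: "?Z \<longleftrightarrow> dz = lift_hamiltonian \<phi> x0 F \<Gamma> q + dx \<bullet> p + dxn * pn"
    by auto
  show ?thesis
    unfolding lift_field_eq[OF q] prod.inject D D0 using True dp by auto
next
  case False
  then show ?thesis by (auto simp: lift_field_eq[OF q] vec_eq_iff)
qed

section \<open>Equations of motion along a curve\<close>

lemma has_real_derivative_along:
  assumes "(\<gamma> has_vector_derivative V) (at t)" "(f has_derivative f') (at (\<gamma> t))"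
  shows "((\<lambda>s. f (\<gamma> s)) has_real_derivative f' V) (at t)"
proof -
  have "((\<lambda>s. f (\<gamma> s)) has_derivative (\<lambda>d. f' (d *\<^sub>R V))) (at t)"
    using has_derivative_compose[OF assms(1)[unfolded has_vector_derivative_def] assms(2)] .
  then show ?thesis
    using linear_cmul[OF has_derivative_linear[OF assms(2)]]
    by (simp add: has_field_derivative_def mult_commute_abs)
qed

lemma differentiable_vec:
  fixes f :: "'a::real_normed_vector \<Rightarrow> real^'n::finite"
  assumes "\<And>a. (\<lambda>s. f s $ a) differentiable F"
  shows "f differentiable F"
proof -
  have "f = (\<lambda>s. \<Sum>a\<in>UNIV. f s $ a *\<^sub>R axis a 1)"
    using basis_expansion[of "f _"] by (simp add: scalar_mult_eq_scaleR fun_eq_iff)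
  moreover have "(\<lambda>s. f s $ a *\<^sub>R (axis a 1 :: real^'n)) differentiable F" for a
    using assms[of a] has_derivative_scaleR_left unfolding differentiable_def by blast
  then have "(\<lambda>s. \<Sum>a\<in>UNIV. f s $ a *\<^sub>R (axis a 1 :: real^'n)) differentiable F"
    by (intro differentiable_sum) auto
  ultimately show ?thesis by metis
qed

lemma differentiable_along:
  "(\<gamma> :: real \<Rightarrow> 'a::real_normed_vector) differentiable (at t) \<Longrightarrow>
    f differentiable (at (\<gamma> t)) \<Longrightarrow> (\<lambda>s. f (\<gamma> s)) differentiable (at t)"
  using differentiable_chain_at[of \<gamma> t f] by (simp add: o_def)

text \<open>If the curve has a velocity at \<open>t\<close>, uniqueness of derivatives turns each
  equation on the right into a condition on that velocity, and \<open>lift_field_iff\<close>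
  applies. If it has none, the left side fails at once, and the right side fails because x and z are
  differentiable expressions in the quantities whose derivatives are prescribed.\<close>

lemma lift_field_curve_iff:
  fixes \<gamma> :: "real \<Rightarrow> 'n::finite extended"
  assumes x0: "x0 \<noteq> 0"
    and \<phi>: "\<phi> differentiable (at (p_coord (\<gamma> t)))" "\<And>a. pd a \<phi> differentiable (at (p_coord (\<gamma> t)))"
    and sym: "\<And>a i. pd a (pd i \<phi>) (p_coord (\<gamma> t)) = pd i (pd a \<phi>) (p_coord (\<gamma> t))"
  shows "(\<gamma> has_vector_derivative lift_field \<phi> x0 F \<Gamma> (\<gamma> t)) (at t) \<longleftrightarrow>
    (\<forall>a. ((\<lambda>s. p_coord (\<gamma> s) $ a) has_real_derivative F a (p_coord (\<gamma> t))) (at t)) \<and>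
    ((\<lambda>s. pn_coord (\<gamma> s)) has_real_derivative
       - (1 / x0) * (\<Sum>i\<in>UNIV. pd i \<phi> (p_coord (\<gamma> t)) * F i (p_coord (\<gamma> t)))) (at t) \<and>
    ((\<lambda>s. xn_coord (\<gamma> s)) has_real_derivative
       deriv \<Gamma> (Delta0 \<phi> x0 (\<gamma> t)) * (x0 - xn_coord (\<gamma> t))) (at t) \<and>
    (\<forall>a. ((\<lambda>s. Delta \<phi> x0 a (\<gamma> s)) has_real_derivative
       - (\<Sum>i\<in>UNIV. pd a (F i) (p_coord (\<gamma> t)) * Delta \<phi> x0 i (\<gamma> t))
       - deriv \<Gamma> (Delta0 \<phi> x0 (\<gamma> t)) * Delta \<phi> x0 a (\<gamma> t)) (at t)) \<and>
    ((\<lambda>s. Delta0 \<phi> x0 (\<gamma> s)) has_real_derivative - \<Gamma> (Delta0 \<phi> x0 (\<gamma> t))) (at t)"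
    (is "?L \<longleftrightarrow> (\<forall>a. ?p a) \<and> ?pn \<and> ?xn \<and> (\<forall>a. ?D a) \<and> ?Z")
proof -
  obtain x xn p pn z where q: "\<gamma> t = (x, xn, p, pn, z)" by (metis prod_cases5)
  have p: "p_coord (\<gamma> t) = p" "xn_coord (\<gamma> t) = xn" by (simp_all add: q)
  have main: "?L \<longleftrightarrow> (\<forall>a. ?p a) \<and> ?pn \<and> ?xn \<and> (\<forall>a. ?D a) \<and> ?Z"
    if V: "(\<gamma> has_vector_derivative V) (at t)" for V
  proof -
    obtain dx dxn dp dpn dz where V_eq: "V = (dx, dxn, dp, dpn, dz)" by (metis prod_cases5)
    have iff: "(f has_real_derivative c) (at t) \<longleftrightarrow> d = c"
      if "(f has_real_derivative d) (at t)" for f c d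
    proof
      show "d = c" if "(f has_real_derivative c) (at t)"
        using \<open>(f has_real_derivative d) (at t)\<close> that by (rule DERIV_unique)
    qed (use that in simp)
    have L_iff: "?L \<longleftrightarrow> V = lift_field \<phi> x0 F \<Gamma> (\<gamma> t)"
    proof
      show "V = lift_field \<phi> x0 F \<Gamma> (\<gamma> t)" if ?L
        using V that by (rule vector_derivative_unique_at)
    qed (use V in simp)
    have p_iff: "?p a \<longleftrightarrow> dp $ a = F a p" for a
      using has_real_derivative_along[OF V bounded_linear_imp_has_derivative[OF
          bounded_linear_compose[OF bounded_linear_vec_nth bounded_linear_projections(1)]], THEN iff]
      by (simp add: V_eq p)
    have pn_iff: "?pn \<longleftrightarrow> dpn = - (1 / x0) * (\<Sum>i\<in>UNIV. pd i \<phi> p * F i p)"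
      using has_real_derivative_along[OF V bounded_linear_imp_has_derivative[OF
          bounded_linear_projections(2)], THEN iff]
      by (simp add: V_eq p)
    have xn_iff: "?xn \<longleftrightarrow> dxn = deriv \<Gamma> (Delta0 \<phi> x0 (\<gamma> t)) * (x0 - xn)"
      using has_real_derivative_along[OF V bounded_linear_imp_has_derivative[OF
          bounded_linear_projections(3)], THEN iff]
      by (simp add: V_eq p)
    have D_iff: "?D a \<longleftrightarrow> dx $ a - dxn / x0 * pd a \<phi> p - xn / x0 * (grad (pd a \<phi>) p \<bullet> dp) =
      - (\<Sum>i\<in>UNIV. pd a (F i) p * Delta \<phi> x0 i (\<gamma> t))
      - deriv \<Gamma> (Delta0 \<phi> x0 (\<gamma> t)) * Delta \<phi> x0 a (\<gamma> t)" for a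
      using has_real_derivative_along[OF V Delta_has_derivative[OF \<phi>(2)[unfolded p],
            where x = x and xn = xn and pn = pn and z = z, folded q], THEN iff]
      by (simp add: V_eq p)
    have Z_iff: "?Z \<longleftrightarrow> dx \<bullet> p + x \<bullet> dp + dxn * pn + (xn - x0) * dpn - grad \<phi> p \<bullet> dp - dz
        = - \<Gamma> (Delta0 \<phi> x0 (\<gamma> t))"
      using has_real_derivative_along[OF V Delta0_has_derivative[OF \<phi>(1)[unfolded p],
            where x = x and xn = xn and pn = pn and z = z, folded q], THEN iff]
      by (simp add: V_eq p)
    show ?thesis
      unfolding L_iff p_iff pn_iff xn_iff D_iff Z_iff V_eq
      by (rule lift_field_iff[OF q x0 sym[unfolded p]])
  qed
  have R_diff: "\<gamma> differentiable (at t)" if R: "(\<forall>a. ?p a) \<and> ?pn \<and> ?xn \<and> (\<forall>a. ?D a) \<and> ?Z"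
  proof -
    have diff: "f differentiable (at t)" if "(f has_real_derivative c) (at t)" for f c
      unfolding real_differentiable_def using that by (rule exI)
    note R = R[THEN conjunct1, rule_format] R[THEN conjunct2, THEN conjunct1]
      R[THEN conjunct2, THEN conjunct2, THEN conjunct1]
      R[THEN conjunct2, THEN conjunct2, THEN conjunct2, THEN conjunct1, rule_format]
      R[THEN conjunct2, THEN conjunct2, THEN conjunct2, THEN conjunct2]
    have dp: "(\<lambda>s. p_coord (\<gamma> s)) differentiable (at t)"
      by (rule differentiable_vec) (rule diff[OF R(1)])
    note dpn = diff[OF R(2)] and dxn = diff[OF R(3)] and D = diff[OF R(4)] and D0 = diff[OF R(5)]
    \<comment> \<open>The definition of \<open>Delta\<close> solved for the a-th component of x;
      below, \<open>Delta0\<close> is solved for z in the same way. Division by \<open>x0\<close> is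
      written as multiplication to fit the product rule.\<close>
    have "(\<lambda>s. Delta \<phi> x0 a (\<gamma> s) + xn_coord (\<gamma> s) * inverse x0 * pd a \<phi> (p_coord (\<gamma> s)))
        differentiable (at t)" for a
      using differentiable_along[OF dp \<phi>(2)] dxn D
      by (intro differentiable_add differentiable_mult) auto
    then have dx: "(\<lambda>s. fst (\<gamma> s)) differentiable (at t)"
      by (intro differentiable_vec)
        (simp add: Delta_def xn_coord_def p_coord_def case_prod_beta divide_inverse)
    have "(\<lambda>s. fst (\<gamma> s) \<bullet> p_coord (\<gamma> s) + (xn_coord (\<gamma> s) - x0) * pn_coord (\<gamma> s)
        - \<phi> (p_coord (\<gamma> s)) - Delta0 \<phi> x0 (\<gamma> s)) differentiable (at t)"
      using differentiable_along[OF dp \<phi>(1)] dx dp dxn dpn D0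
      by (intro differentiable_add differentiable_diff differentiable_mult differentiable_inner) auto
    then have dz: "(\<lambda>s. snd (snd (snd (snd (\<gamma> s))))) differentiable (at t)"
      by (simp add: Delta0_def xn_coord_def p_coord_def pn_coord_def case_prod_beta sum_mult_inner)
    have "(\<lambda>s. (fst (\<gamma> s), xn_coord (\<gamma> s), p_coord (\<gamma> s), pn_coord (\<gamma> s), snd (snd (snd (snd (\<gamma> s))))))
        differentiable (at t)"
      by (intro differentiable_Pair dx dxn dp dpn dz)
    then show ?thesis
      by (simp add: xn_coord_def p_coord_def pn_coord_def case_prod_beta)
  qed
  show ?thesis
  proof (cases "\<gamma> differentiable (at t)")
    case True
    then show ?thesis by (intro main) (simp add: vector_derivative_works)
  next
    case False
    have "\<not> ?L" using False by (rule contrapos_nn) (rule differentiableI_vector)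
    have "\<not> ((\<forall>a. ?p a) \<and> ?pn \<and> ?xn \<and> (\<forall>a. ?D a) \<and> ?Z)"
      using False by (rule contrapos_nn) (rule R_diff)
    have both_false: "A \<longleftrightarrow> B" if "\<not> A" "\<not> B" for A B using that by blast
    show ?thesis by (rule both_false) fact+
  qed
qed

subsection \<open>Flows and their lifts\<close>

lemma flow_reaches_unique:
  fixes X :: "'a::real_inner \<Rightarrow> 'a"
  assumes "\<And>q. q \<in> M \<Longrightarrow> lipschitz_near q X"
    and "flow_reaches M X t q y" "flow_reaches M X t q y'"
  shows "y = y'"
proof -
  obtain J \<gamma> where J: "integral_curve M X J \<gamma>" "0 \<in> J" "t \<in> J" "\<gamma> 0 = q" "\<gamma> t = y"
    using assms(2) unfolding flow_reaches_def by blast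
  obtain I \<delta> where I: "integral_curve M X I \<delta>" "0 \<in> I" "t \<in> I" "\<delta> 0 = q" "\<delta> t = y'"
    using assms(3) unfolding flow_reaches_def by blast
  have "\<gamma> 0 = \<delta> 0" using J I by simp
  then show ?thesis
    using integral_curve_unique[OF assms(1) J(1) I(1) J(2) I(2) _ J(3) I(3)] J(5) I(5) by simp
qed

text \<open>A time in \<open>flow_domain\<close> comes with a curve reaching it. The image of that
  curve reaches the projected endpoint, and uniqueness in both spaces identifies the endpoints with
  the values of \<open>flow\<close>.\<close>

lemma flow_lift_by_curves:
  assumes \<pi>: "\<And>q. q \<in> M \<Longrightarrow> \<pi> q \<in> N"
    and M: "\<And>t q y y'. flow_reaches M X t q y \<Longrightarrow> flow_reaches M X t q y' \<Longrightarrow> y = y'"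
    and N: "\<And>t q y y'. flow_reaches N Y t q y \<Longrightarrow> flow_reaches N Y t q y' \<Longrightarrow> y = y'"
    and curves: "\<And>J \<gamma>. integral_curve M X J \<gamma> \<Longrightarrow> integral_curve N Y J (\<lambda>t. \<pi> (\<gamma> t))"
  shows "flow_lift \<pi> M X N Y"
  unfolding flow_lift_def
proof (intro conjI ballI)
  fix q t assume "q \<in> M" and t: "t \<in> flow_domain M X q"
  then obtain y where y: "flow_reaches M X t q y" unfolding flow_domain_def by blast
  then obtain J \<gamma> where J: "integral_curve M X J \<gamma>" "0 \<in> J" "t \<in> J" "\<gamma> 0 = q" "\<gamma> t = y"
    unfolding flow_reaches_def by blast
  have \<pi>y: "flow_reaches N Y t (\<pi> q) (\<pi> y)"
    unfolding flow_reaches_def using curves[OF J(1)] J(2-) by blast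
  show "t \<in> flow_domain N Y (\<pi> q)" using \<pi>y unfolding flow_domain_def by blast
  have "flow M X t q = y" unfolding flow_def using y M by blast
  moreover have "flow N Y t (\<pi> q) = \<pi> y" unfolding flow_def using \<pi>y N by blast
  ultimately show "\<pi> (flow M X t q) = flow N Y t (\<pi> q)" by simp
qed (rule \<pi>)

text \<open>The middle component of \<open>legendre_param\<close> is \<open>p\<close> itself, so by
  uniqueness of derivatives the middle component of its derivative is the identity. The second part
  thus reads the p-velocity off a tangent vector of the submanifold.\<close>

lemma legendre_param_has_derivative:
  assumes "\<phi> differentiable (at p)" "\<And>a. pd a \<phi> differentiable (at p)"
  shows "(legendre_param \<phi> has_derivative frechet_derivative (legendre_param \<phi>) (at p)) (at p)"
    and "fst (snd (frechet_derivative (legendre_param \<phi>) (at p) v)) = v"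
proof -
  have "(\<lambda>p. \<chi> a. pd a \<phi> p) differentiable (at p)"
    using assms(2) by (intro differentiable_vec) simp
  moreover have "(\<lambda>p. \<Sum>a\<in>UNIV. p $ a * pd a \<phi> p) differentiable (at p)"
    by (intro differentiable_sum ballI differentiable_mult assms(2)
        bounded_linear_imp_differentiable[OF bounded_linear_vec_nth]) simp
  ultimately have "(\<lambda>p. legendre_param \<phi> p) differentiable (at p)"
    unfolding legendre_param_def using assms(1)
    by (intro differentiable_Pair differentiable_diff) auto
  then show L: "(legendre_param \<phi> has_derivative frechet_derivative (legendre_param \<phi>) (at p)) (at p)"
    by (simp add: frechet_derivative_works)
  have "((\<lambda>p. p) has_derivative
      (\<lambda>v. fst (snd (frechet_derivative (legendre_param \<phi>) (at p) v)))) (at p)"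
    using has_derivative_fst[OF has_derivative_snd[OF L]] by (simp add: legendre_param_def)
  from has_derivative_unique[OF this has_derivative_ident]
  show "fst (snd (frechet_derivative (legendre_param \<phi>) (at p) v)) = v" by meson
qed

section \<open>Local Lipschitz property of the lifted field\<close>

lemma deriv_lipschitz_near:
  fixes \<Gamma> :: "real \<Rightarrow> real"
  assumes "open T" "smooth_on T \<Gamma>" "t \<in> T"
  shows "lipschitz_near t (deriv \<Gamma>)"
proof (rule lipschitz_near_cong[OF assms(1,3)])
  show "lipschitz_near t (\<lambda>x. frechet_derivative \<Gamma> (at x) 1)"
    by (rule smooth_on_imp_lipschitz_near[OF assms(1,3) smooth_on_frechet_derivative[OF assms(2)]])
  \<comment> \<open>Smoothness speaks of the Frechet derivative, the field of \<open>deriv\<close>;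
    differentiability on \<open>T\<close> identifies the two there.\<close>
  show "frechet_derivative \<Gamma> (at x) 1 = deriv \<Gamma> x" if "x \<in> T" for x
  proof -
    have "(\<Gamma> has_derivative (\<lambda>d. deriv \<Gamma> x * d)) (at x)"
      using smooth_on_differentiable[OF assms(2) that]
      by (simp add: DERIV_deriv_iff_real_differentiable has_field_derivative_imp_has_derivative)
    from frechet_derivative_at[OF this] show ?thesis by (metis mult.right_neutral)
  qed
qed

text \<open>With division by \<open>x0\<close> rewritten as multiplication by a constant, every
  component is built by sums and products from coordinates, smooth functions of p and smooth
  functions of \<open>Delta0\<close>, so the closure rules follow the syntax of the formula.\<close>

lemma lift_field_lipschitz_near:
  fixes q :: "'n::finite extended"
  assumes "open P" "open T" and q: "p_coord q \<in> P" "Delta0 \<phi> x0 q \<in> T"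
    and \<phi>: "smooth_on P \<phi>" and F: "\<And>a. smooth_on P (F a)" and \<Gamma>: "smooth_on T \<Gamma>"
  shows "lipschitz_near q (lift_field \<phi> x0 F \<Gamma>)"
proof -
  have on_p: "lipschitz_near q (\<lambda>q. f (fst (snd (snd q))))" if "smooth_on P f" for f :: "real^'n \<Rightarrow> real"
    using lipschitz_near_compose[OF lipschitz_near_bounded_linear[OF bounded_linear_projections(1)]
        smooth_on_imp_lipschitz_near[OF \<open>open P\<close> q(1) that]]
    by (simp add: p_coord_def case_prod_beta)
  have coord: "lipschitz_near q (\<lambda>q. fst q $ a)" "lipschitz_near q (\<lambda>q. fst (snd (snd q)) $ a)"
    "lipschitz_near q (\<lambda>q. fst (snd q))" "lipschitz_near q (\<lambda>q. fst (snd (snd (snd q))))"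
    "lipschitz_near q (\<lambda>q. snd (snd (snd (snd q))))" for a
    by (intro lipschitz_near_bounded_linear bounded_linear_compose[OF bounded_linear_vec_nth]
        bounded_linear_fst_comp bounded_linear_snd_comp bounded_linear_ident)+
  note arith = lipschitz_near_add lipschitz_near_diff lipschitz_near_minus lipschitz_near_mult
    lipschitz_near_sum lipschitz_near_const
  note p_funs = on_p[OF \<phi>] on_p[OF smooth_on_pd[OF \<phi>]] on_p[OF smooth_on_pd[OF smooth_on_pd[OF \<phi>]]]
    on_p[OF F] on_p[OF smooth_on_pd[OF F]]
  have Delta: "lipschitz_near q (Delta \<phi> x0 a)" for a
    unfolding Delta_def case_prod_beta divide_inverse by (intro coord p_funs arith)
  have Delta0: "lipschitz_near q (Delta0 \<phi> x0)"
    unfolding Delta0_def case_prod_beta by (intro coord p_funs arith)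
  have \<Gamma>_Delta0: "lipschitz_near q (\<lambda>q. \<Gamma> (Delta0 \<phi> x0 q))"
    "lipschitz_near q (\<lambda>q. deriv \<Gamma> (Delta0 \<phi> x0 q))"
    using lipschitz_near_compose[OF Delta0] smooth_on_imp_lipschitz_near[OF \<open>open T\<close> q(2) \<Gamma>]
      deriv_lipschitz_near[OF \<open>open T\<close> \<Gamma> q(2)] by blast+
  show ?thesis
    unfolding lift_field_def Let_def case_prod_beta prod.collapse divide_inverse
    by (intro lipschitz_near_Pair lipschitz_near_vec coord p_funs Delta \<Gamma>_Delta0 arith)
qed

theorem proposition5p3:
  fixes U :: "'n::finite extended set"
    and P :: "(real^'n) set"
    and T :: "real set"
    and \<phi> :: "real^'n \<Rightarrow> real"
    and x0 :: real
    and F :: "'n \<Rightarrow> real^'n \<Rightarrow> real"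
    and \<Gamma> :: "real \<Rightarrow> real"
  assumes "open U" and "open P" and "open T"
    and "p_coord ` U \<subseteq> P" and "Delta0 \<phi> x0 ` U \<subseteq> T"
    and "smooth_on P \<phi>"
    and "\<And>a. smooth_on P (F a)"
    and "\<exists>a. \<exists>p\<in>P. F a p \<noteq> 0"
    and "smooth_on T \<Gamma>"
    and "x0 \<noteq> 0"
  shows "flow_lift (legendre_proj \<phi>) U (lift_field \<phi> x0 F \<Gamma>)
           (legendre_submanifold P \<phi>) (legendre_field \<phi> F) \<and>
         (\<forall>J \<gamma>. integral_curve U (lift_field \<phi> x0 F \<Gamma>) J \<gamma> \<longleftrightarrow>
           open J \<and> is_interval J \<and>
           (\<forall>t\<in>J. \<gamma> t \<in> U \<and>
              (\<forall>a. ((\<lambda>s. p_coord (\<gamma> s) $ a) has_real_derivative F a (p_coord (\<gamma> t))) (at t)) \<and>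
              ((\<lambda>s. pn_coord (\<gamma> s)) has_real_derivative
                 - (1 / x0) * (\<Sum>i\<in>UNIV. pd i \<phi> (p_coord (\<gamma> t)) * F i (p_coord (\<gamma> t)))) (at t) \<and>
              ((\<lambda>s. xn_coord (\<gamma> s)) has_real_derivative
                 deriv \<Gamma> (Delta0 \<phi> x0 (\<gamma> t)) * (x0 - xn_coord (\<gamma> t))) (at t) \<and>
              (\<forall>a. ((\<lambda>s. Delta \<phi> x0 a (\<gamma> s)) has_real_derivative
                 - (\<Sum>i\<in>UNIV. pd a (F i) (p_coord (\<gamma> t)) * Delta \<phi> x0 i (\<gamma> t))
                 - deriv \<Gamma> (Delta0 \<phi> x0 (\<gamma> t)) * Delta \<phi> x0 a (\<gamma> t)) (at t)) \<and>
              ((\<lambda>s. Delta0 \<phi> x0 (\<gamma> s)) has_real_derivative - \<Gamma> (Delta0 \<phi> x0 (\<gamma> t))) (at t))) \<and>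
         contact_hamiltonian_field U (lift_hamiltonian \<phi> x0 F \<Gamma>) (lift_field \<phi> x0 F \<Gamma>) \<and>
         (\<forall>Y. contact_hamiltonian_field U (lift_hamiltonian \<phi> x0 F \<Gamma>) Y \<longrightarrow>
           (\<forall>q\<in>U. Y q = lift_field \<phi> x0 F \<Gamma> q)) \<and>
         (\<forall>q\<in>U. lie_deriv_fun (lift_field \<phi> x0 F \<Gamma>) (phi_ext \<phi> x0) q = 0)"
proof -
  let ?X = "lift_field \<phi> x0 F \<Gamma>" and ?h = "lift_hamiltonian \<phi> x0 F \<Gamma>"
    and ?N = "legendre_submanifold P \<phi>" and ?Y = "legendre_field \<phi> F"
  have in_P: "p_coord q \<in> P" and in_T: "Delta0 \<phi> x0 q \<in> T" if "q \<in> U" for q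
    using that assms(4,5) by auto
  have d\<phi>: "\<phi> differentiable (at p)" "pd a \<phi> differentiable (at p)" "F a differentiable (at p)"
    if "p \<in> P" for p a
    using that assms(6,7) smooth_on_pd smooth_on_differentiable by blast+

  \<comment> \<open>Stated for an arbitrary vector \<open>V\<close>, so that one equivalence gives
    both the Hamiltonian property and the uniqueness of the field.\<close>
  have contact: "contact_form q V = ?h q \<and>
      (\<forall>v. ext_deriv contact_form q V v =
        - (frechet_derivative ?h (at q) v - pd_z ?h q * contact_form q v)) \<longleftrightarrow> V = ?X q"
    if "q \<in> U" for q V
  proof -
    obtain x xn p pn z where q: "q = (x, xn, p, pn, z)" by (metis prod_cases5)
    have p: "p \<in> P" using in_P[OF that] by (simp add: q)
    show ?thesis
      unfolding contact_hamiltonian_coordinates[OF q lift_hamiltonian_has_derivative[OF q d\<phi>[OF p]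
            smooth_on_differentiable[OF assms(9) in_T[OF that]]]] lift_field_eq[OF q]
      by (simp add: algebra_simps)
  qed

  have lie: "lie_deriv_fun ?X (phi_ext \<phi> x0) q = 0" if "q \<in> U" for q
  proof -
    obtain x xn p pn z where q: "q = (x, xn, p, pn, z)" by (metis prod_cases5)
    have p: "p \<in> P" using in_P[OF that] by (simp add: q)
    have "(phi_ext \<phi> x0 has_derivative
        (\<lambda>v. grad \<phi> p \<bullet> fst (snd (snd v)) + fst (snd (snd (snd v))) * x0)) (at q)"
      unfolding phi_ext_def case_prod_beta q
      by (auto intro!: derivative_eq_intros has_derivative_fst_snd_comp[OF d\<phi>(1)[OF p]])
    \<comment> \<open>Here \<open>x0\<close> times the pn-component is minus the derivative of
      \<phi> along \<open>F\<close>, which cancels the contribution of the p-component.\<close>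
    from frechet_derivative_at[OF this, symmetric] show ?thesis
      using assms(10) by (simp add: lie_deriv_fun_def lift_field_eq[OF q] inner_vec_def grad_def)
  qed

  have curve: "integral_curve P (\<lambda>p. \<chi> a. F a p) J (\<lambda>t. p_coord (\<gamma> t))"
    if "integral_curve U ?X J \<gamma>" for J \<gamma>
    unfolding integral_curve_def
  proof (intro conjI ballI)
    fix t assume t: "t \<in> J"
    obtain x xn p pn z where q: "\<gamma> t = (x, xn, p, pn, z)" by (metis prod_cases5)
    show "p_coord (\<gamma> t) \<in> P" using in_P that t unfolding integral_curve_def by blast
    have "(\<gamma> has_vector_derivative ?X (\<gamma> t)) (at t)"
      using that t unfolding integral_curve_def by blast
    from bounded_linear.has_vector_derivative[OF bounded_linear_projections(1) this]
    show "((\<lambda>t. p_coord (\<gamma> t)) has_vector_derivative (\<chi> a. F a (p_coord (\<gamma> t)))) (at t)"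
      by (simp add: lift_field_eq[OF q]) (simp add: q)
  qed (use that in \<open>simp_all add: integral_curve_def\<close>)

  have param_curve: "integral_curve ?N ?Y J (\<lambda>t. legendre_param \<phi> (\<delta> t))"
    if "integral_curve P (\<lambda>p. \<chi> a. F a p) J \<delta>" for J \<delta>
    unfolding integral_curve_def
  proof (intro conjI ballI)
    fix t assume "t \<in> J"
    then have t: "\<delta> t \<in> P" "(\<delta> has_vector_derivative (\<chi> a. F a (\<delta> t))) (at t)"
      using that unfolding integral_curve_def by auto
    show "legendre_param \<phi> (\<delta> t) \<in> ?N" using t(1) by (simp add: legendre_submanifold_def)
    let ?L = "frechet_derivative (legendre_param \<phi>) (at (\<delta> t))"
    note L = legendre_param_has_derivative(1)[OF d\<phi>(1,2)[OF t(1)]]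
    have "((\<lambda>t. legendre_param \<phi> (\<delta> t)) has_derivative (\<lambda>d. ?L (d *\<^sub>R (\<chi> a. F a (\<delta> t))))) (at t)"
      using has_derivative_compose[OF t(2)[unfolded has_vector_derivative_def] L] .
    then have "((\<lambda>t. legendre_param \<phi> (\<delta> t)) has_vector_derivative ?L (\<chi> a. F a (\<delta> t))) (at t)"
      using linear_cmul[OF has_derivative_linear[OF L]] by (simp add: has_vector_derivative_def)
    then show "((\<lambda>t. legendre_param \<phi> (\<delta> t)) has_vector_derivative ?Y (legendre_param \<phi> (\<delta> t))) (at t)"
      by (simp add: legendre_field_def legendre_param_def[of _ "\<delta> t"])
  qed (use that in \<open>simp_all add: integral_curve_def\<close>)

  have N_point: "y = legendre_param \<phi> (fst (snd y)) \<and> fst (snd y) \<in> P" if "y \<in> ?N" for y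
    using that by (auto simp: legendre_submanifold_def legendre_param_def)
  have N_curve: "integral_curve P (\<lambda>p. \<chi> a. F a p) J (\<lambda>t. fst (snd (\<gamma> t)))"
    if "integral_curve ?N ?Y J \<gamma>" for J \<gamma>
    unfolding integral_curve_def
  proof (intro conjI ballI)
    fix t assume "t \<in> J"
    then have t: "\<gamma> t \<in> ?N" "(\<gamma> has_vector_derivative ?Y (\<gamma> t)) (at t)"
      using that unfolding integral_curve_def by auto
    show p: "fst (snd (\<gamma> t)) \<in> P" using N_point[OF t(1)] by blast
    have "bounded_linear (\<lambda>y :: (real^'n) \<times> (real^'n) \<times> real. fst (snd y))"
      by (intro bounded_linear_fst_comp bounded_linear_snd_comp bounded_linear_ident)
    from bounded_linear.has_vector_derivative[OF this t(2)]
    show "((\<lambda>t. fst (snd (\<gamma> t))) has_vector_derivative (\<chi> a. F a (fst (snd (\<gamma> t))))) (at t)"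
      by (simp add: legendre_field_def case_prod_beta legendre_param_has_derivative(2)[OF d\<phi>(1,2)[OF p]])
  qed (use that in \<open>simp_all add: integral_curve_def\<close>)

  have F_lipschitz: "lipschitz_near p (\<lambda>p. \<chi> a. F a p)" if "p \<in> P" for p
    using that assms(2,7) by (intro lipschitz_near_vec smooth_on_imp_lipschitz_near)
  \<comment> \<open>The chart p sends integral curves on the submanifold to integral curves of
    \<open>F\<close> in the open set \<open>P\<close>, where the Lipschitz argument applies; a point
    of the submanifold is determined by its middle component.\<close>
  have N_unique: "y = y'" if "flow_reaches ?N ?Y t q y" "flow_reaches ?N ?Y t q y'" for t q y y'
  proof -
    have "flow_reaches P (\<lambda>p. \<chi> a. F a p) t (fst (snd q)) (fst (snd y)) \<and> y \<in> ?N"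
      if "flow_reaches ?N ?Y t q y" for y
    proof -
      obtain J \<gamma> where J: "integral_curve ?N ?Y J \<gamma>" "0 \<in> J" "t \<in> J" "\<gamma> 0 = q" "\<gamma> t = y"
        using \<open>flow_reaches ?N ?Y t q y\<close> unfolding flow_reaches_def by blast
      have "y \<in> ?N" using J unfolding integral_curve_def by blast
      then show ?thesis
        unfolding flow_reaches_def using N_curve[OF J(1)] J(2-) by blast
    qed
    note y = this[OF that(1)] and y' = this[OF that(2)]
    have "fst (snd y) = fst (snd y')"
      by (rule flow_reaches_unique[OF F_lipschitz y[THEN conjunct1] y'[THEN conjunct1]])
    then show ?thesis using N_point[of y] N_point[of y'] y y' by simp
  qed

  have lift: "flow_lift (legendre_proj \<phi>) U ?X ?N ?Y"
  proof (rule flow_lift_by_curves[OF _ _ N_unique])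
    show "legendre_proj \<phi> q \<in> ?N" if "q \<in> U" for q
      using in_P[OF that] by (simp add: legendre_proj_def legendre_submanifold_def)
    show "y = y'" if "flow_reaches U ?X t q y" "flow_reaches U ?X t q y'" for t q y y'
      by (rule flow_reaches_unique[OF lift_field_lipschitz_near[OF assms(2,3) in_P in_T assms(6,7,9)]
            that])
    show "integral_curve ?N ?Y J (\<lambda>t. legendre_proj \<phi> (\<gamma> t))" if "integral_curve U ?X J \<gamma>" for J \<gamma>
      unfolding legendre_proj_def by (rule param_curve[OF curve[OF that]])
  qed
  note curve_iff = lift_field_curve_iff[OF assms(10) d\<phi>(1,2)[OF in_P]
      pd_commute[OF assms(2) in_P assms(6)]]
  show ?thesis
  proof (intro conjI allI)
    show "flow_lift (legendre_proj \<phi>) U ?X ?N ?Y" by (rule lift)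
    show "contact_hamiltonian_field U ?h ?X"
      unfolding contact_hamiltonian_field_def using contact by blast
    show "contact_hamiltonian_field U ?h Y \<longrightarrow> (\<forall>q\<in>U. Y q = ?X q)" for Y
      unfolding contact_hamiltonian_field_def using contact by blast
    show "\<forall>q\<in>U. lie_deriv_fun ?X (phi_ext \<phi> x0) q = 0" using lie by blast
  \<comment> \<open>The remaining goal is the equivalence for integral curves. The congruence rules
    supply \<open>\<gamma> t \<in> U\<close>, which \<open>curve_iff\<close> needs in order to place
    the momentum in \<open>P\<close>.\<close>
  qed (unfold integral_curve_def, intro conj_cong ball_cong refl curve_iff)
qed

end
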